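(* Let $X$ be a subshift. Then $$\mathrm{Soc}\big(\widetilde{\mathcal A}_{\mathbb C}(X)\big)\subseteq\mathrm{Soc}\big(\widetilde{\mathcal O}_X\big),$$ where $\widetilde{\mathcal A}_{\mathbb C}(X)$ is regarded as a dense subalgebra of the unital subshift C*-algebra $\widetilde{\mathcal O}_X$.
   Context: Notation: $\mathbb N=\{0,1,2,\dots\}$. Let $\mathfrak A$ be a nonempty set (the alphabet) and let $\mathfrak A^*$ be the set of finite words over $\mathfrak A$, including the empty word $\omega$. A subshift over $\mathfrak A$ is a set $X\subseteq\mathfrak A^{\mathbb N}$ of the form $X=X_F$ for some $F\subseteq\mathfrak A^*$, where $X_F$ is the set of all sequences in which no word of $F$ occurs as a block. Every letter of $\mathfrak A$ is assumed to occur in some element of $X$. The language $\mathcal L_X$ is the set of all finite words (including $\omega$) occurring in some element of $X$. For $\alpha,\beta\in\mathcal L_X$ put $C(\alpha,\beta)=\{\beta x\in X:\alpha x\in X\}$. Let $\mathcal U$ be the Boolean algebra of subsets of $X$ generated by all $C(\alpha,\beta)$, $\alpha,\beta\in\mathcal L_X$ (closed under finite unions, finite intersections and complements in $X$). The unital subshift algebra $\widetilde{\mathcal A}_{\mathbb C}(X)$ is the universal unital (associative) $\mathbb C$-algebra with generators $\{p_A:A\in\mathcal U\}$ and $\{s_a,s_a^*:a\in\mathfrak A\}$ subject to: (i) $p_X=1$, $p_{A\cap B}=p_Ap_B$, $p_{A\cup B}=p_A+p_B-p_{A\cap B}$, $p_\emptyset=0$ for all $A,B\in\mathcal U$; (ii)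 $s_as_a^*s_a=s_a$ and $s_a^*s_as_a^*=s_a^*$ for all $a\in\mathfrak A$; (iii) $s_\beta s_\alpha^*s_\alpha s_\beta^*=p_{C(\alpha,\beta)}$ for all $\alpha,\beta\in\mathcal L_X$, where $s_\omega=s_\omega^*=1$, $s_\alpha=s_{\alpha_1}\cdots s_{\alpha_n}$ and $s_\alpha^*=s_{\alpha_n}^*\cdots s_{\alpha_1}^*$ for $\alpha=\alpha_1\cdots\alpha_n$. The C*-algebra $\widetilde{\mathcal O}_X$ is the universal unital C*-algebra generated by projections $\{p_A:A\in\mathcal U\}$ and partial isometries $\{s_a:a\in\mathfrak A\}$ subject to relations (i) and (iii). It is known that the homomorphism $\widetilde{\mathcal A}_{\mathbb C}(X)\to\widetilde{\mathcal O}_X$ sending generators to generators is injective with dense image, and $\widetilde{\mathcal A}_{\mathbb C}(X)$ is identified with its image. The socle $\mathrm{Soc}(B)$ of an algebra $B$ (including a C*-algebra) is the sum of all its minimal left ideals, not necessarily closed (zero if there are none). *)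

theory Defs
  imports
    Complex_Main
    "HOL-Algebra.QuotRing"
    "HOL-Algebra.Module"
    "HOL-Library.Poly_Mapping"
    "HOL-Library.Omega_Words_Fun"
begin

section \<open>Subshifts\<close>

text \<open>The alphabet is the (automatically nonempty, otherwise arbitrary) type \<open>'a\<close>; one-sided
  sequences have type \<open>'a word = nat \<Rightarrow> 'a\<close>, finite words type \<open>'a list\<close>, and \<open>\<frown>\<close> is
  concatenation of a finite word and a sequence.\<close>

definition occurs_in :: "'a list \<Rightarrow> 'a word \<Rightarrow> bool" where
  "occurs_in w x \<longleftrightarrow> (\<exists>i. subsequence x i (i + length w) = w)"

definition avoiding :: "'a list set \<Rightarrow> 'a word set" where
  "avoiding F = {x. \<forall>w\<in>F. \<not> occurs_in w x}"

definition subshift :: "'a word set \<Rightarrow> bool" where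
  "subshift X \<longleftrightarrow> (\<exists>F. X = avoiding F)"

definition language :: "'a word set \<Rightarrow> 'a list set" where
  "language X = {w. \<exists>x\<in>X. occurs_in w x}"

definition cyl :: "'a word set \<Rightarrow> 'a list \<Rightarrow> 'a list \<Rightarrow> 'a word set" where
  "cyl X \<alpha> \<beta> = {\<beta> \<frown> x | x. \<beta> \<frown> x \<in> X \<and> \<alpha> \<frown> x \<in> X}"

inductive_set bool_alg :: "'a word set \<Rightarrow> 'a word set set" for X where
  cyl: "\<alpha> \<in> language X \<Longrightarrow> \<beta> \<in> language X \<Longrightarrow> cyl X \<alpha> \<beta> \<in> bool_alg X"
| Un: "A \<in> bool_alg X \<Longrightarrow> B \<in> bool_alg X \<Longrightarrow> A \<union> B \<in> bool_alg X"
| Int: "A \<in> bool_alg X \<Longrightarrow> B \<in> bool_alg X \<Longrightarrow> A \<inter> B \<in> bool_alg X"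
| compl: "A \<in> bool_alg X \<Longrightarrow> X - A \<in> bool_alg X"


section \<open>Unital complex algebras: quotients and the socle\<close>

text \<open>A complex algebra is represented by a record \<open>(complex, 'b) module\<close>, which carries a ring
  structure together with a scalar multiplication \<open>\<odot>\<close>.\<close>

definition alg_quot :: "(complex, 'b, 'm) module_scheme \<Rightarrow> 'b set \<Rightarrow> (complex, 'b set) module" where
  "alg_quot M I = ring.extend (M Quot I)
     (module.fields (\<lambda>c C. \<Union>x\<in>C. I +>\<^bsub>M\<^esub> (c \<odot>\<^bsub>M\<^esub> x)))"

definition left_ideal :: "'b set \<Rightarrow> (complex, 'b, 'm) module_scheme \<Rightarrow> bool" where
  "left_ideal L M \<longleftrightarrow> additive_subgroup L M
     \<and> (\<forall>a\<in>carrier M. \<forall>x\<in>L. a \<otimes>\<^bsub>M\<^esub> x \<in> L) \<and> (\<forall>c. \<forall>x\<in>L. c \<odot>\<^bsub>M\<^esub> x \<in> L)"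

definition minimal_left_ideal :: "'b set \<Rightarrow> (complex, 'b, 'm) module_scheme \<Rightarrow> bool" where
  "minimal_left_ideal L M \<longleftrightarrow> left_ideal L M \<and> L \<noteq> {\<zero>\<^bsub>M\<^esub>}
     \<and> (\<forall>J. left_ideal J M \<and> J \<subseteq> L \<longrightarrow> J = {\<zero>\<^bsub>M\<^esub>} \<or> J = L)"

definition Soc :: "(complex, 'b, 'm) module_scheme \<Rightarrow> 'b set" where
  "Soc M = {finsum M f \<L> | f \<L>. finite \<L> \<and> (\<forall>L\<in>\<L>. minimal_left_ideal L M \<and> f L \<in> L)}"


section \<open>The free algebra on the generators\<close>

text \<open>Finite words form the free monoid, so \<open>'g list \<Rightarrow>\<^sub>0 complex\<close> with the convolution product of
  \<open>Poly_Mapping\<close> is the free unital complex algebra on \<open>'g\<close>.\<close>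

instantiation list :: (type) monoid_add
begin
definition zero_list :: "'a list" where "zero_list = []"
definition plus_list :: "'a list \<Rightarrow> 'a list \<Rightarrow> 'a list" where "plus_list = (@)"
instance by standard (simp_all add: zero_list_def plus_list_def)
end

datatype 'a gen = Proj "'a word set" | Iso 'a | IsoAdj 'a

type_synonym 'a ncpoly = "'a gen list \<Rightarrow>\<^sub>0 complex"

definition gens :: "'a word set \<Rightarrow> 'a gen set" where
  "gens X = Proj ` bool_alg X \<union> range Iso \<union> range IsoAdj"

definition free_alg :: "'a word set \<Rightarrow> (complex, 'a ncpoly) module" where
  "free_alg X = \<lparr>carrier = {f. \<forall>w\<in>Poly_Mapping.keys f. set w \<subseteq> gens X},
     mult = (*), one = 1, zero = 0, add = (+), smult = (\<lambda>c. Poly_Mapping.map ((*) c))\<rparr>"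

definition of_gen :: "'a gen \<Rightarrow> 'a ncpoly" where
  "of_gen g = Poly_Mapping.single [g] 1"

abbreviation "p A \<equiv> of_gen (Proj A)"
abbreviation "s a \<equiv> of_gen (Iso a)"
abbreviation "s_adj a \<equiv> of_gen (IsoAdj a)"

definition s_word :: "'a list \<Rightarrow> 'a ncpoly" where
  "s_word \<alpha> = prod_list (map s \<alpha>)"

definition s_word_adj :: "'a list \<Rightarrow> 'a ncpoly" where
  "s_word_adj \<alpha> = prod_list (map s_adj (rev \<alpha>))"

text \<open>An element \<open>u - v\<close> of the following set stands for the relation \<open>u = v\<close>.\<close>

inductive_set relators :: "'a word set \<Rightarrow> 'a ncpoly set" for X where
  "p X - 1 \<in> relators X"
| "A \<in> bool_alg X \<Longrightarrow> B \<in> bool_alg X \<Longrightarrow> p (A \<inter> B) - p A * p B \<in> relators X"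
| "A \<in> bool_alg X \<Longrightarrow> B \<in> bool_alg X \<Longrightarrow>
     p (A \<union> B) - (p A + p B - p (A \<inter> B)) \<in> relators X"
| "p {} - 0 \<in> relators X"
| "s a * s_adj a * s a - s a \<in> relators X"
| "s_adj a * s a * s_adj a - s_adj a \<in> relators X"
| "\<alpha> \<in> language X \<Longrightarrow> \<beta> \<in> language X \<Longrightarrow>
     s_word \<beta> * s_word_adj \<alpha> * s_word \<alpha> * s_word_adj \<beta> - p (cyl X \<alpha> \<beta>) \<in> relators X"

definition subshift_alg :: "'a word set \<Rightarrow> (complex, 'a ncpoly set) module" where
  "subshift_alg X = alg_quot (free_alg X) (Idl\<^bsub>free_alg X\<^esub> (relators X))"


section \<open>The universal C*-algebra\<close>

text \<open>The conjugate-linear, product-reversing involution of the free algebra under which each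
  \<open>p A\<close> is self-adjoint and \<open>s a\<close>, \<open>s_adj a\<close> are adjoint to each other.\<close>

fun gen_star :: "'a gen \<Rightarrow> 'a gen" where
  "gen_star (Proj A) = Proj A"
| "gen_star (Iso a) = IsoAdj a"
| "gen_star (IsoAdj a) = Iso a"

definition star :: "'a ncpoly \<Rightarrow> 'a ncpoly" where
  "star f = (\<Sum>w\<in>Poly_Mapping.keys f.
     Poly_Mapping.single (rev (map gen_star w)) (cnj (Poly_Mapping.lookup f w)))"

text \<open>C*-seminorms on the free *-algebra that annihilate the relations. Since \<open>p A\<close> is
  self-adjoint by the choice of \<open>star\<close> and idempotent by the relation for \<open>A \<inter> A\<close>, and
  the relations \<open>s s* s = s\<close> are among the relators, the generators become projections and partial
  isometries.\<close>

definition cstar_seminorm :: "'a word set \<Rightarrow> ('a ncpoly \<Rightarrow> real) \<Rightarrow> bool" where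
  "cstar_seminorm X q \<longleftrightarrow>
     (\<forall>x\<in>carrier (free_alg X). 0 \<le> q x)
   \<and> (\<forall>x\<in>carrier (free_alg X). \<forall>y\<in>carrier (free_alg X). q (x + y) \<le> q x + q y)
   \<and> (\<forall>c. \<forall>x\<in>carrier (free_alg X). q (c \<odot>\<^bsub>free_alg X\<^esub> x) = cmod c * q x)
   \<and> (\<forall>x\<in>carrier (free_alg X). \<forall>y\<in>carrier (free_alg X). q (x * y) \<le> q x * q y)
   \<and> (\<forall>x\<in>carrier (free_alg X). q (star x * x) = (q x)\<^sup>2)
   \<and> (\<forall>r\<in>relators X. q r = 0)"

text \<open>The largest C*-seminorm. The supremum is finite because every C*-seminorm is at most \<open>1\<close> on
  projections and partial isometries (see \<open>cstar_seminorm_bdd\<close> below).\<close>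

definition univ_seminorm :: "'a word set \<Rightarrow> 'a ncpoly \<Rightarrow> real" where
  "univ_seminorm X x = (SUP q\<in>{q. cstar_seminorm X q}. q x)"

record 'b cstar_alg = "(complex, 'b) module" +
  adj :: "'b \<Rightarrow> 'b"
  nrm :: "'b \<Rightarrow> real"

text \<open>Hausdorff completion of an algebra \<open>M\<close> with involution \<open>st\<close> with respect to a seminorm \<open>q\<close>:
  Cauchy sequences with pointwise operations modulo null sequences.\<close>

definition cauchy_alg ::
    "(complex, 'b, 'm) module_scheme \<Rightarrow> ('b \<Rightarrow> real) \<Rightarrow> (complex, nat \<Rightarrow> 'b) module" where
  "cauchy_alg M q = \<lparr>
     carrier = {u. (\<forall>n. u n \<in> carrier M) \<and>
                   (\<forall>e>0. \<exists>N. \<forall>m\<ge>N. \<forall>n\<ge>N. q (u m \<ominus>\<^bsub>M\<^esub> u n) < e)},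
     mult = (\<lambda>u v n. u n \<otimes>\<^bsub>M\<^esub> v n), one = (\<lambda>_. \<one>\<^bsub>M\<^esub>), zero = (\<lambda>_. \<zero>\<^bsub>M\<^esub>),
     add = (\<lambda>u v n. u n \<oplus>\<^bsub>M\<^esub> v n), smult = (\<lambda>c u n. c \<odot>\<^bsub>M\<^esub> u n)\<rparr>"

definition null_seqs ::
    "(complex, 'b, 'm) module_scheme \<Rightarrow> ('b \<Rightarrow> real) \<Rightarrow> (nat \<Rightarrow> 'b) set" where
  "null_seqs M q = {u. (\<forall>n. u n \<in> carrier M) \<and> (\<lambda>n. q (u n)) \<longlonglongrightarrow> 0}"

definition completion ::
    "(complex, 'b, 'm) module_scheme \<Rightarrow> ('b \<Rightarrow> 'b) \<Rightarrow> ('b \<Rightarrow> real) \<Rightarrow> (nat \<Rightarrow> 'b) set cstar_alg" where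
  "completion M st q = module.extend (alg_quot (cauchy_alg M q) (null_seqs M q))
     (cstar_alg.fields
        (\<lambda>C. \<Union>u\<in>C. null_seqs M q +>\<^bsub>cauchy_alg M q\<^esub> (\<lambda>n. st (u n)))
        (\<lambda>C. THE r. \<forall>u\<in>C. (\<lambda>n. q (u n)) \<longlonglongrightarrow> r))"

definition subshift_cstar :: "'a word set \<Rightarrow> (nat \<Rightarrow> 'a ncpoly) set cstar_alg" where
  "subshift_cstar X = completion (free_alg X) star (univ_seminorm X)"

text \<open>The homomorphism sending generators to generators: the class of a polynomial is sent to the
  class of the constant sequence. All the sets in the union coincide, as \<open>univ_seminorm\<close> vanishes
  on the ideal of relations.\<close>

definition canonical_map :: "'a word set \<Rightarrow> 'a ncpoly set \<Rightarrow> (nat \<Rightarrow> 'a ncpoly) set" where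
  "canonical_map X C = (\<Union>x\<in>C.
     null_seqs (free_alg X) (univ_seminorm X)
       +>\<^bsub>cauchy_alg (free_alg X) (univ_seminorm X)\<^esub> (\<lambda>_. x))"


section \<open>Well-definedness\<close>

text \<open>The following facts show that the generated ideal and the supremum above are meaningful:
  the relators lie in the carrier, and the C*-seminorms are pointwise bounded.\<close>

lemma free_alg_carrier: "f \<in> carrier (free_alg X) \<longleftrightarrow> (\<forall>w\<in>Poly_Mapping.keys f. set w \<subseteq> gens X)"
  by (simp add: free_alg_def)

lemma free_alg_simps [simp]:
  "mult (free_alg X) = (*)" "one (free_alg X) = 1" "zero (free_alg X) = 0"
  "add (free_alg X) = (+)" "smult (free_alg X) c = Poly_Mapping.map ((*) c)"
  by (simp_all add: free_alg_def)

lemma free_alg_closed: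
  assumes "x \<in> carrier (free_alg X)" "y \<in> carrier (free_alg X)"
  shows "x + y \<in> carrier (free_alg X)" "- x \<in> carrier (free_alg X)"
    "x - y \<in> carrier (free_alg X)" "x * y \<in> carrier (free_alg X)"
proof -
  show "x + y \<in> carrier (free_alg X)"
    using assms Poly_Mapping.keys_add[of x y] unfolding free_alg_carrier by blast
  show "- x \<in> carrier (free_alg X)"
    using assms unfolding free_alg_carrier by simp
  show "x - y \<in> carrier (free_alg X)"
    using assms keys_diff[of x y] unfolding free_alg_carrier by blast
  show "x * y \<in> carrier (free_alg X)"
    using assms keys_mult[of x y] unfolding free_alg_carrier
    by (fastforce simp: plus_list_def)
qed

lemma free_alg_zero_one:
  "0 \<in> carrier (free_alg X)" "1 \<in> carrier (free_alg X)"
  by (auto simp: free_alg_carrier zero_list_def)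

lemma free_alg_ring: "ring (free_alg X)"
proof (rule ringI)
  show "abelian_group (free_alg X)"
  proof (rule abelian_groupI)
    fix x assume "x \<in> carrier (free_alg X)"
    then show "\<exists>y\<in>carrier (free_alg X). y \<oplus>\<^bsub>free_alg X\<^esub> x = \<zero>\<^bsub>free_alg X\<^esub>"
      by (intro bexI[of _ "- x"]) (auto intro: free_alg_closed)
  qed (auto simp: free_alg_closed free_alg_zero_one add.assoc add.commute)
  show "Group.monoid (free_alg X)"
    by (rule monoidI) (auto simp: free_alg_closed free_alg_zero_one mult.assoc)
qed (auto simp: algebra_simps)

lemma of_gen_carrier: "of_gen g \<in> carrier (free_alg X) \<longleftrightarrow> g \<in> gens X"
  by (simp add: free_alg_carrier of_gen_def)

lemma s_carrier: "s a \<in> carrier (free_alg X)" "s_adj a \<in> carrier (free_alg X)"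
  by (auto simp: of_gen_carrier gens_def)

lemma s_word_carrier: "s_word \<alpha> \<in> carrier (free_alg X)" "s_word_adj \<alpha> \<in> carrier (free_alg X)"
proof -
  show "s_word \<alpha> \<in> carrier (free_alg X)"
    unfolding s_word_def by (induction \<alpha>) (auto simp: free_alg_zero_one intro!: free_alg_closed s_carrier)
  have "prod_list (map s_adj w) \<in> carrier (free_alg X)" for w
    by (induction w) (auto simp: free_alg_zero_one intro!: free_alg_closed s_carrier)
  then show "s_word_adj \<alpha> \<in> carrier (free_alg X)" by (simp add: s_word_adj_def)
qed

lemma empty_in_language: "X \<noteq> {} \<Longrightarrow> [] \<in> language X"
  by (auto simp: language_def occurs_in_def)

lemma X_in_bool_alg: "X \<noteq> {} \<Longrightarrow> X \<in> bool_alg X"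
  using bool_alg.cyl[OF empty_in_language empty_in_language, of X] by (simp add: cyl_def)

lemma relators_carrier:
  assumes "X \<noteq> {}" shows "relators X \<subseteq> carrier (free_alg X)"
proof
  have X: "X \<in> bool_alg X" and e: "{} \<in> bool_alg X"
    using X_in_bool_alg[OF assms] bool_alg.compl[of X X] by auto
  have P: "p A \<in> carrier (free_alg X)" if "A \<in> bool_alg X" for A
    using that by (simp add: of_gen_carrier gens_def)
  fix r assume "r \<in> relators X"
  then show "r \<in> carrier (free_alg X)"
    by cases (use X e in \<open>auto intro!: free_alg_closed P s_carrier s_word_carrier
      free_alg_zero_one intro: bool_alg.intros\<close>)
qed

lemma star_of_gen: "star (of_gen g) = of_gen (gen_star g)"
  by (simp add: star_def of_gen_def)

lemma cstar_seminorm_bdd: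
  assumes "X \<noteq> {}" "x \<in> carrier (free_alg X)"
  shows "bdd_above {q x | q. cstar_seminorm X q}"
proof -
  let ?F = "carrier (free_alg X)"
  have bound: "q x \<le> (\<Sum>w\<in>Poly_Mapping.keys x. cmod (Poly_Mapping.lookup x w))"
    if q: "cstar_seminorm X q" for q
  proof -
    note qs = q[unfolded cstar_seminorm_def]
    have nn: "\<And>x. x \<in> ?F \<Longrightarrow> 0 \<le> q x"
      and tri: "\<And>x y. x \<in> ?F \<Longrightarrow> y \<in> ?F \<Longrightarrow> q (x + y) \<le> q x + q y"
      and hom: "\<And>c x. x \<in> ?F \<Longrightarrow> q (Poly_Mapping.map ((*) c) x) = cmod c * q x"
      and sub: "\<And>x y. x \<in> ?F \<Longrightarrow> y \<in> ?F \<Longrightarrow> q (x * y) \<le> q x * q y"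
      and cs: "\<And>x. x \<in> ?F \<Longrightarrow> q (star x * x) = (q x)\<^sup>2"
      and rel: "\<And>r. r \<in> relators X \<Longrightarrow> q r = 0"
      using qs by auto
    have "Poly_Mapping.map ((*) 0) 0 = (0 :: 'a ncpoly)"
      by (rule poly_mapping_eqI) (simp add: Poly_Mapping.map.rep_eq)
    then have q0: "q 0 = 0" using hom[of 0 0] by (simp add: free_alg_zero_one)
    have eq: "q u = q v" if "u \<in> ?F" "v \<in> ?F" "q (u - v) = 0" for u v
    proof -
      have "Poly_Mapping.map ((*) (-1)) (u - v) = v - u"
        by (rule poly_mapping_eqI) (simp add: Poly_Mapping.map.rep_eq lookup_minus when_def)
      then have "q (v - u) = 0" using hom[of "u - v" "-1"] that by (simp add: free_alg_closed)
      moreover have "q u \<le> q (u - v) + q v" using tri[of "u - v" v] that by (simp add: free_alg_closed)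
      moreover have "q v \<le> q (v - u) + q u" using tri[of "v - u" u] that by (simp add: free_alg_closed)
      ultimately show ?thesis using that by simp
    qed
    have le1: "r \<le> 1" if "r\<^sup>2 = r" for r :: real
      using that by (auto simp: power2_eq_square)
    have "rev (map gen_star (0 :: 'a gen list)) = 0" by (simp add: zero_list_def)
    then have star1: "star 1 = (1 :: 'a ncpoly)" by (simp add: star_def)
    have one: "q 1 \<le> 1"
    proof (rule le1)
      show "(q 1)\<^sup>2 = q 1" using cs[of 1] by (simp add: star1 free_alg_zero_one)
    qed
    have P: "q (p A) \<le> 1" if "A \<in> bool_alg X" for A
    proof (rule le1)
      have A: "p A \<in> ?F" using that by (simp add: of_gen_carrier gens_def)
      have "q (p A - p A * p A) = 0" using relators.intros(2)[OF that that] rel by simp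
      then have "q (p A) = q (p A * p A)" using eq A by (simp add: free_alg_closed)
      also have "\<dots> = (q (p A))\<^sup>2" using cs[OF A] by (simp add: star_of_gen)
      finally show "(q (p A))\<^sup>2 = q (p A)" by simp
    qed
    have S: "q u \<le> 1" if "u \<in> ?F" "v \<in> ?F" "star u = v" "star (v * u) = v * u"
      "u * v * u - u \<in> relators X" for u v
    proof -
      have vu: "v * u \<in> ?F" using that by (simp add: free_alg_closed)
      have "q (v * (u * v * u - u)) \<le> q v * 0"
        using sub[of v "u * v * u - u"] rel[OF that(5)] that by (simp add: free_alg_closed)
      then have "q ((v * u) * (v * u) - v * u) = 0"
        using nn[of "(v * u) * (v * u) - v * u"] free_alg_closed(3)[OF free_alg_closed(4)[OF vu vu] vu]
        by (simp add: algebra_simps)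
      then have "q (v * u) = q ((v * u) * (v * u))" using eq vu by (simp add: free_alg_closed)
      also have "\<dots> = (q (v * u))\<^sup>2" using cs[OF vu] that(4) by simp
      finally have "q (v * u) \<le> 1" using le1 by metis
      then have "(q u)\<^sup>2 \<le> 1" using cs[OF that(1)] that(3) by simp
      then show ?thesis using power2_le_imp_le[of "q u" 1] by simp
    qed
    have gen: "q (of_gen g) \<le> 1" if "g \<in> gens X" for g
    proof (cases g)
      case (Proj A) then show ?thesis using that P by (auto simp: gens_def)
    next
      case (Iso a)
      have "star (s_adj a * s a) = s_adj a * s a"
        by (simp add: star_def of_gen_def mult_single plus_list_def)
      then show ?thesis using S[of "s a" "s_adj a"] Iso relators.intros(5)[of a X]
        by (simp add: s_carrier star_of_gen)
    next
      case (IsoAdj a)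
      have "star (s a * s_adj a) = s a * s_adj a"
        by (simp add: star_def of_gen_def mult_single plus_list_def)
      then show ?thesis using S[of "s_adj a" "s a"] IsoAdj relators.intros(6)[of a X]
        by (simp add: s_carrier star_of_gen)
    qed
    have word: "q (Poly_Mapping.single w 1) \<le> 1" if "set w \<subseteq> gens X" for w
      using that
    proof (induction w)
      case Nil then show ?case using one by (simp add: zero_list_def[symmetric])
    next
      case (Cons g w)
      have w: "Poly_Mapping.single w 1 \<in> ?F" using Cons.prems by (simp add: free_alg_carrier)
      have g: "of_gen g \<in> ?F" using Cons.prems by (simp add: of_gen_carrier)
      have "Poly_Mapping.single (g # w) 1 = of_gen g * Poly_Mapping.single w 1"
        by (simp add: of_gen_def mult_single plus_list_def)
      then have "q (Poly_Mapping.single (g # w) 1) \<le> q (of_gen g) * q (Poly_Mapping.single w 1)"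
        using sub[OF g w] by simp
      also have "\<dots> \<le> 1 * 1"
        using Cons gen nn[OF w] nn[OF g] by (intro mult_mono) auto
      finally show ?case by simp
    qed
    have single: "q (Poly_Mapping.single w c) \<le> cmod c" if "set w \<subseteq> gens X" for w c
    proof -
      have "Poly_Mapping.single w c = Poly_Mapping.map ((*) c) (Poly_Mapping.single w 1)"
        by (rule poly_mapping_eqI) (simp add: Poly_Mapping.map.rep_eq lookup_single when_def)
      then have "q (Poly_Mapping.single w c) = cmod c * q (Poly_Mapping.single w 1)"
        using hom[of "Poly_Mapping.single w 1" c] that by (simp add: free_alg_carrier)
      also have "\<dots> \<le> cmod c * 1" by (intro mult_left_mono word that) auto
      finally show ?thesis by simp
    qed
    have "(\<Sum>w\<in>W. Poly_Mapping.single w (f w)) \<in> ?F \<and>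
        q (\<Sum>w\<in>W. Poly_Mapping.single w (f w)) \<le> (\<Sum>w\<in>W. cmod (f w))"
      if "finite W" "\<forall>w\<in>W. set w \<subseteq> gens X" for W f
      using that
    proof (induction W)
      case empty then show ?case by (simp add: q0 free_alg_zero_one)
    next
      case (insert w W)
      have w: "Poly_Mapping.single w (f w) \<in> ?F" using insert.prems by (simp add: free_alg_carrier)
      show ?case
        using insert single[of w "f w"] tri[OF w, of "\<Sum>w\<in>W. Poly_Mapping.single w (f w)"] w
        by (auto intro!: free_alg_closed)
    qed
    moreover have "(\<Sum>w\<in>Poly_Mapping.keys x. Poly_Mapping.single w (Poly_Mapping.lookup x w)) = x"
      by (rule poly_mapping_eqI) (simp add: lookup_sum lookup_single when_def in_keys_iff)
    ultimately show ?thesis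
      using assms(2) free_alg_carrier[of x X] finite_keys[of x] by metis
  qed
  then show ?thesis unfolding bdd_above_def by blast
qed


end

theory Submission
  imports Defs
begin

text \<open>Let \<open>A\<close> be a *-algebra with a C*-seminorm \<open>q\<close>, \<open>I\<close> an ideal on which \<open>q\<close> vanishes, and \<open>L\<close> a
  minimal left ideal of \<open>A / I\<close>. If \<open>q\<close> vanishes on \<open>L\<close>, its image in the completion is zero.
  Otherwise pick \<open>x \<in> L\<close> with \<open>q x \<noteq> 0\<close> and put \<open>h = x\<^sup>* x \<in> L\<close>. The C*-identity shows that \<open>h\<^sup>2\<close> is
  not null, so by minimality \<open>h = a h\<^sup>2\<close> up to null elements, and \<open>e = a h\<close> is a projection with
  \<open>L = L e\<close>. The corner \<open>e A e\<close> is a normed division algebra, hence \<open>\<complex> e\<close> (Gelfand--Mazur; no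
  completeness is needed). By density \<open>e B e = \<complex> e\<close> in the completion \<open>B\<close>, where \<open>y\<^sup>* y\<close> is then a
  nonzero multiple of \<open>e\<close> for every nonzero \<open>y \<in> B e\<close>; so \<open>B e\<close> is a minimal left ideal containing
  the image of \<open>L\<close>.

  For the Gelfand--Mazur step it is enough to treat a self-adjoint \<open>b\<close> of norm \<open>1\<close>. If all
  \<open>e - z b\<close> with \<open>|z| = 1\<close> were invertible, \<open>t \<mapsto> (e - exp (i t) b)\<^sup>-\<^sup>1\<close> would be Lipschitz by
  compactness. Passing from \<open>b\<close> to \<open>b\<^sup>2\<close> halves the Lipschitz constant and keeps the norm, while
  norm \<open>1\<close> bounds the constant from below.\<close>

section \<open>Algebras with a C*-seminorm\<close>

text \<open>A unital complex *-algebra with a C*-seminorm, carried by a subset of a ring. The scalars are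
  represented by central elements \<open>\<iota> c\<close>, so that scalar multiplication is ring multiplication.\<close>

locale cstar_seminormed =
  fixes A :: "'b::ring_1 set" and \<iota> :: "complex \<Rightarrow> 'b" and st :: "'b \<Rightarrow> 'b" and q :: "'b \<Rightarrow> real"
  assumes scalar_closed [simp]: "\<iota> c \<in> A"
    and diff_closed [simp]: "x \<in> A \<Longrightarrow> y \<in> A \<Longrightarrow> x - y \<in> A"
    and mult_closed [simp]: "x \<in> A \<Longrightarrow> y \<in> A \<Longrightarrow> x * y \<in> A"
    and scalar_add: "\<iota> (c + d) = \<iota> c + \<iota> d"
    and scalar_mult: "\<iota> (c * d) = \<iota> c * \<iota> d"
    and scalar_1 [simp]: "\<iota> 1 = 1"
    and scalar_comm: "x \<in> A \<Longrightarrow> x * \<iota> c = \<iota> c * x"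
    and star_closed [simp]: "x \<in> A \<Longrightarrow> st x \<in> A"
    and star_add: "x \<in> A \<Longrightarrow> y \<in> A \<Longrightarrow> st (x + y) = st x + st y"
    and star_mult: "x \<in> A \<Longrightarrow> y \<in> A \<Longrightarrow> st (x * y) = st y * st x"
    and star_star [simp]: "x \<in> A \<Longrightarrow> st (st x) = x"
    and star_scalar: "st (\<iota> c) = \<iota> (cnj c)"
    and q_nonneg [simp]: "x \<in> A \<Longrightarrow> 0 \<le> q x"
    and q_triangle: "x \<in> A \<Longrightarrow> y \<in> A \<Longrightarrow> q (x + y) \<le> q x + q y"
    and q_scalar: "x \<in> A \<Longrightarrow> q (\<iota> c * x) = cmod c * q x"
    and q_mult: "x \<in> A \<Longrightarrow> y \<in> A \<Longrightarrow> q (x * y) \<le> q x * q y"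
    and q_star_mult: "x \<in> A \<Longrightarrow> q (st x * x) = (q x)\<^sup>2"
begin

section \<open>Rules for scalars, involution and seminorm\<close>

lemma scalar_0 [simp]: "\<iota> 0 = 0"
  using scalar_add[of 0 0] by simp

lemma scalar_minus: "\<iota> (- c) = - \<iota> c"
  using scalar_add[of c "- c"] by (simp add: eq_neg_iff_add_eq_0 add.commute)

lemma one_closed [simp]: "1 \<in> A"
  using scalar_closed[of 1] by simp

lemma zero_closed [simp]: "0 \<in> A"
  using scalar_closed[of 0] by simp

lemma uminus_closed [simp]: "x \<in> A \<Longrightarrow> - x \<in> A"
  using diff_closed[of 0 x] by simp

lemma add_closed [simp]: "x \<in> A \<Longrightarrow> y \<in> A \<Longrightarrow> x + y \<in> A"
  using diff_closed[of x "- y"] by simp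

lemma star_minus: "x \<in> A \<Longrightarrow> st (- x) = - st x"
  using star_mult[of "\<iota> (-1)" x] star_scalar[of "-1"] by (simp add: scalar_minus)

lemma star_diff: "x \<in> A \<Longrightarrow> y \<in> A \<Longrightarrow> st (x - y) = st x - st y"
  using star_add[of x "- y"] by (simp add: star_minus)

lemma star_scale: "x \<in> A \<Longrightarrow> st (\<iota> c * x) = \<iota> (cnj c) * st x"
  by (simp add: star_mult star_scalar scalar_comm)

lemma q_0 [simp]: "q 0 = 0"
  using q_scalar[of 0 0] by simp

lemma q_minus [simp]: "x \<in> A \<Longrightarrow> q (- x) = q x"
  using q_scalar[of x "-1"] by (simp add: scalar_minus)

lemma q_eq_0I: "x \<in> A \<Longrightarrow> q x \<le> 0 \<Longrightarrow> q x = 0"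
  by (simp add: order_antisym)

lemma q_diff_comm: "x \<in> A \<Longrightarrow> y \<in> A \<Longrightarrow> q (x - y) = q (y - x)"
  using q_minus[of "x - y"] by simp

lemma q_triangle_diff: "x \<in> A \<Longrightarrow> y \<in> A \<Longrightarrow> q (x - y) \<le> q x + q y"
  using q_triangle[of x "- y"] by simp

text \<open>The C*-identity and submultiplicativity give
  \<open>q y * q y \<le> q (st y) * q y\<close>. Cancelling \<open>q y\<close>, and then exchanging
  \<open>y\<close> with \<open>st y\<close>, yields both inequalities.\<close>

lemma q_star [simp]:
  assumes "x \<in> A" shows "q (st x) = q x"
proof -
  have le: "q y \<le> q (st y)" if "y \<in> A" for y
  proof (cases "q y = 0")
    case False
    then have "0 < q y" using that by (simp add: order.strict_iff_order)
    moreover have "q y * q y \<le> q (st y) * q y"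
      using q_star_mult[OF that] q_mult[of "st y" y] that by (simp add: power2_eq_square)
    ultimately show ?thesis by simp
  qed (use that in simp)
  show ?thesis using le[OF assms] le[of "st x"] assms by simp
qed

text \<open>Equality of the images in the normed algebra \<open>A / ker q\<close>.\<close>

definition eqv :: "'b \<Rightarrow> 'b \<Rightarrow> bool" (infix \<open>\<approx>\<close> 50) where
  "x \<approx> y \<longleftrightarrow> x \<in> A \<and> y \<in> A \<and> q (x - y) = 0"

lemma eqv_refl [simp]: "x \<in> A \<Longrightarrow> x \<approx> x"
  by (simp add: eqv_def)

lemma eqv_sym: "x \<approx> y \<Longrightarrow> y \<approx> x"
  by (simp add: eqv_def q_diff_comm)

lemma eqv_trans [trans]:
  assumes "x \<approx> y" "y \<approx> z" shows "x \<approx> z"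
  using assms q_triangle[of "x - y" "y - z"] q_eq_0I[of "x - z"] by (auto simp: eqv_def)

lemma eqv_0_iff: "x \<approx> 0 \<longleftrightarrow> x \<in> A \<and> q x = 0"
  by (simp add: eqv_def)

lemma eqv_iff_diff: "x \<in> A \<Longrightarrow> y \<in> A \<Longrightarrow> x \<approx> y \<longleftrightarrow> x - y \<approx> 0"
  by (simp add: eqv_def)

lemma eqv_add: "x \<approx> y \<Longrightarrow> u \<approx> v \<Longrightarrow> x + u \<approx> y + v"
  using q_triangle[of "x - y" "u - v"] q_eq_0I[of "x - y + (u - v)"]
  by (auto simp: eqv_def add_diff_add)

lemma eqv_minus: "x \<approx> y \<Longrightarrow> - x \<approx> - y"
  using q_minus[of "x - y"] by (simp add: eqv_def)

lemma eqv_diff: "x \<approx> y \<Longrightarrow> u \<approx> v \<Longrightarrow> x - u \<approx> y - v"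
  using eqv_add[OF _ eqv_minus] by simp

lemma eqv_mult:
  assumes "x \<approx> y" "u \<approx> v" shows "x * u \<approx> y * v"
proof -
  have cl: "x \<in> A" "y \<in> A" "u \<in> A" "v \<in> A" using assms by (simp_all add: eqv_def)
  have "q ((x - y) * u) \<le> 0" "q (y * (u - v)) \<le> 0"
    using q_mult[of "x - y" u] q_mult[of y "u - v"] assms cl by (simp_all add: eqv_def)
  moreover have "x * u - y * v = (x - y) * u + y * (u - v)" by (simp add: algebra_simps)
  ultimately show ?thesis
    using q_triangle[of "(x - y) * u" "y * (u - v)"] q_eq_0I[of "x * u - y * v"] cl
    by (auto simp: eqv_def)
qed

lemma eqv_mult_left: "a \<in> A \<Longrightarrow> x \<approx> y \<Longrightarrow> a * x \<approx> a * y"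
  by (simp add: eqv_mult)

lemma eqv_mult_right: "a \<in> A \<Longrightarrow> x \<approx> y \<Longrightarrow> x * a \<approx> y * a"
  by (simp add: eqv_mult)

lemma eqv_star: "x \<approx> y \<Longrightarrow> st x \<approx> st y"
  using q_star[of "x - y"] by (auto simp: eqv_def star_diff)

lemma q_cong:
  assumes "x \<approx> y" shows "q x = q y"
  using assms q_triangle[of "x - y" y] q_triangle[of "y - x" x] q_diff_comm[of x y]
  by (simp add: eqv_def)

section \<open>The corner of a projection, modulo null elements\<close>

definition corner :: "'b \<Rightarrow> 'b set" where
  "corner e = {x \<in> A. e * x \<approx> x \<and> x * e \<approx> x}"

text \<open>An inverse is determined only up to \<open>\<approx>\<close>, so inversion is a relation
  between representatives rather than a function.\<close>

definition corner_inverse :: "'b \<Rightarrow> 'b \<Rightarrow> 'b \<Rightarrow> bool" where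
  "corner_inverse e x r \<longleftrightarrow> r \<in> corner e \<and> r * x \<approx> e \<and> x * r \<approx> e"

end

text \<open>Self-adjointness of \<open>e\<close> can be arranged exactly by the choice of the
  representative; idempotence is available only modulo null elements.\<close>

locale cstar_seminormed_projection = cstar_seminormed +
  fixes e
  assumes e_closed [simp]: "e \<in> A" and e_star [simp]: "st e = e" and e_idem: "e * e \<approx> e"
    and e_nonzero: "q e \<noteq> 0"
begin

text \<open>By the C*-identity \<open>q e\<close> equals its own square, and it is nonzero.\<close>

lemma q_e: "q e = 1"
  using q_star_mult[of e] q_cong[OF e_idem] e_nonzero by (simp add: power2_eq_square)

lemma e_in_corner [simp]: "e \<in> corner e"
  by (simp add: corner_def e_idem)

lemma corner_add [simp]: "x \<in> corner e \<Longrightarrow> y \<in> corner e \<Longrightarrow> x + y \<in> corner e"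
  by (simp add: corner_def distrib_left distrib_right eqv_add)

lemma corner_diff [simp]: "x \<in> corner e \<Longrightarrow> y \<in> corner e \<Longrightarrow> x - y \<in> corner e"
  by (simp add: corner_def left_diff_distrib right_diff_distrib eqv_diff)

lemma corner_mult [simp]:
  assumes "x \<in> corner e" "y \<in> corner e" shows "x * y \<in> corner e"
  using eqv_mult_right[of y "e * x" x] eqv_mult_left[of x "y * e" y] assms
  by (simp add: corner_def mult.assoc)

lemma corner_scale [simp]:
  assumes "x \<in> corner e" shows "\<iota> c * x \<in> corner e"
proof -
  have "e * (\<iota> c * x) = \<iota> c * (e * x)"
    by (simp add: scalar_comm flip: mult.assoc)
  then show ?thesis
    using assms eqv_mult_left[of "\<iota> c" "e * x" x] eqv_mult_left[of "\<iota> c" "x * e" x]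
    by (simp add: corner_def mult.assoc)
qed

lemma compression_in_corner [simp]:
  assumes "a \<in> A" shows "e * a * e \<in> corner e"
proof -
  have "(e * e) * (a * e) \<approx> e * (a * e)" "(e * a) * (e * e) \<approx> (e * a) * e"
    using assms by (simp_all add: eqv_mult_right eqv_mult_left e_idem)
  then show ?thesis using assms by (simp add: corner_def mult.assoc)
qed

lemma corner_simps [simp]:
  assumes "x \<in> corner e" shows "x \<in> A" "e * x \<approx> x" "x * e \<approx> x"
  using assms by (simp_all add: corner_def)

lemma corner_inverse_closed: "corner_inverse e x r \<Longrightarrow> r \<in> corner e"
  by (simp add: corner_inverse_def)

text \<open>The usual chain \<open>r = r e = r (x v) = (r x) v = e v = v\<close>. It transfers
  estimates from one choice of inverses to any other.\<close>

lemma corner_inverse_unique: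
  assumes "corner_inverse e x r" "corner_inverse e x v" "x \<in> A" shows "r \<approx> v"
proof -
  have r: "r \<in> corner e" and v: "v \<in> corner e" using assms by (simp_all add: corner_inverse_def)
  have "r \<approx> r * e" using r by (simp add: eqv_sym)
  also have "r * e \<approx> r * (x * v)"
    using assms r by (intro eqv_mult_left eqv_sym[of "x * v"]) (simp_all add: corner_inverse_def)
  also have "r * (x * v) = (r * x) * v" by (simp add: mult.assoc)
  also have "\<dots> \<approx> e * v" using assms v by (simp_all add: eqv_mult_right corner_inverse_def)
  also have "e * v \<approx> v" using v by simp
  finally show ?thesis .
qed

text \<open>The identity \<open>(1 - x\<^sup>2)\<^sup>-\<^sup>1 = ((1 - x)\<^sup>-\<^sup>1 + (1 + x)\<^sup>-\<^sup>1) / 2\<close> in the corner.\<close>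

lemma corner_inverse_average:
  assumes x: "x \<in> corner e" and r: "corner_inverse e (e - x) r" and v: "corner_inverse e (e + x) v"
  shows "corner_inverse e (e - x * x) (\<iota> (1/2) * (r + v))"
proof -
  have cl: "x \<in> A" "r \<in> corner e" "v \<in> corner e" using x r v by (simp_all add: corner_inverse_def)
  have ex: "e * x \<approx> x" "x * e \<approx> x" using x by simp_all
  \<comment> \<open>Both orders of the factors of \<open>e - x * x\<close> are recorded, so that the
    factor to be cancelled can always stand next to its inverse.\<close>
  have "e * e + e * x - x * e - x * x \<approx> e + x - x - x * x"
    using cl by (intro eqv_diff eqv_add e_idem ex eqv_refl) auto
  then have mp: "(e - x) * (e + x) \<approx> e - x * x" by (simp add: algebra_simps)
  have "e * e - e * x + x * e - x * x \<approx> e - x + x - x * x"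
    using cl by (intro eqv_diff eqv_add e_idem ex eqv_refl) auto
  then have pm: "(e + x) * (e - x) \<approx> e - x * x" by (simp add: algebra_simps)
  have cp: "e + x \<in> corner e" "e - x \<in> corner e" using x by simp_all
  have a: "(e - x * x) * r \<approx> e + x"
  proof -
    have "(e - x * x) * r \<approx> (e + x) * (e - x) * r" using cl by (intro eqv_mult_right eqv_sym[OF pm]) simp
    also have "\<dots> = (e + x) * ((e - x) * r)" by (simp add: mult.assoc)
    also have "\<dots> \<approx> (e + x) * e" using r cl by (simp_all add: eqv_mult_left corner_inverse_def)
    also have "\<dots> \<approx> e + x" using cp by simp
    finally show ?thesis .
  qed
  have b: "(e - x * x) * v \<approx> e - x"
  proof -
    have "(e - x * x) * v \<approx> (e - x) * (e + x) * v" using cl by (intro eqv_mult_right eqv_sym[OF mp]) simp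
    also have "\<dots> = (e - x) * ((e + x) * v)" by (simp add: mult.assoc)
    also have "\<dots> \<approx> (e - x) * e" using v cl by (simp_all add: eqv_mult_left corner_inverse_def)
    also have "\<dots> \<approx> e - x" using cp by simp
    finally show ?thesis .
  qed
  have c: "r * (e - x * x) \<approx> e + x"
  proof -
    have "r * (e - x * x) \<approx> r * ((e - x) * (e + x))" using cl by (intro eqv_mult_left eqv_sym[OF mp]) simp
    also have "\<dots> = (r * (e - x)) * (e + x)" by (simp add: mult.assoc)
    also have "\<dots> \<approx> e * (e + x)" using r cl by (simp_all add: eqv_mult_right corner_inverse_def)
    also have "\<dots> \<approx> e + x" using cp by simp
    finally show ?thesis .
  qed
  have d: "v * (e - x * x) \<approx> e - x"
  proof -
    have "v * (e - x * x) \<approx> v * ((e + x) * (e - x))" using cl by (intro eqv_mult_left eqv_sym[OF pm]) simp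
    also have "\<dots> = (v * (e + x)) * (e - x)" by (simp add: mult.assoc)
    also have "\<dots> \<approx> e * (e - x)" using v cl by (simp_all add: eqv_mult_right corner_inverse_def)
    also have "\<dots> \<approx> e - x" using cp by simp
    finally show ?thesis .
  qed
  have half: "\<iota> (1/2) * ((e + x) + (e - x)) = e"
    using scalar_add[of "1/2" "1/2"] by (simp add: distrib_left flip: distrib_right)
  have "(e - x * x) * (\<iota> (1/2) * (r + v)) = \<iota> (1/2) * ((e - x * x) * r + (e - x * x) * v)"
    using scalar_comm[of "e - x * x" "1/2"] cl
    by (simp add: distrib_left flip: mult.assoc)
  also have "\<dots> \<approx> \<iota> (1/2) * ((e + x) + (e - x))"
    by (intro eqv_mult_left eqv_add a b) auto
  finally have 1: "(e - x * x) * (\<iota> (1/2) * (r + v)) \<approx> e" by (simp only: half)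
  have "(\<iota> (1/2) * (r + v)) * (e - x * x) = \<iota> (1/2) * (r * (e - x * x) + v * (e - x * x))"
    by (simp only: distrib_right mult.assoc)
  also have "\<dots> \<approx> \<iota> (1/2) * ((e + x) + (e - x))"
    by (intro eqv_mult_left eqv_add c d) auto
  finally have 2: "(\<iota> (1/2) * (r + v)) * (e - x * x) \<approx> e" by (simp only: half)
  show ?thesis using 1 2 cl by (simp add: corner_inverse_def)
qed

end

section \<open>The Gelfand--Mazur theorem for corners\<close>

text \<open>The chord between two points of the unit circle has length
  \<open>|2 sin ((a - b) / 2)|\<close>, which is at most the arc.\<close>

lemma cmod_cis_diff_le: "cmod (cis a - cis b) \<le> \<bar>a - b\<bar>"
proof -
  have "cos (a - b) = 1 - 2 * (sin ((a - b) / 2))\<^sup>2"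
    using cos_double_sin[of "(a - b) / 2"] by (metis field_sum_of_halves mult_2)
  moreover have "(cos a)\<^sup>2 + (sin a)\<^sup>2 = 1" "(cos b)\<^sup>2 + (sin b)\<^sup>2 = 1" by simp_all
  ultimately have "(cmod (cis a - cis b))\<^sup>2 = (2 * sin ((a - b) / 2))\<^sup>2"
    unfolding cmod_power2 by (simp add: power2_eq_square cos_diff algebra_simps)
  also have "\<dots> \<le> (a - b)\<^sup>2"
    using abs_sin_x_le_abs_x[of "(a - b) / 2"] by (subst abs_le_square_iff [symmetric]) simp
  finally show ?thesis by (simp flip: abs_le_square_iff)
qed

section \<open>Resolvents along the unit circle\<close>

context cstar_seminormed_projection begin

text \<open>The estimate ranges over all inverses because they are unique only up to
  \<open>\<approx>\<close>. With real angles as parameters, taking a square root of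
  \<open>cis t\<close> becomes halving \<open>t\<close>.\<close>

definition resolvent_lipschitz :: "'a \<Rightarrow> real \<Rightarrow> bool" where
  "resolvent_lipschitz b K \<longleftrightarrow> (\<forall>t. \<exists>r. corner_inverse e (e - \<iota> (cis t) * b) r) \<and>
     (\<forall>t u r v. corner_inverse e (e - \<iota> (cis t) * b) r \<longrightarrow> corner_inverse e (e - \<iota> (cis u) * b) v
       \<longrightarrow> q (r - v) \<le> K * \<bar>t - u\<bar>)"

lemma q_diff_cong: "x \<approx> x' \<Longrightarrow> y \<approx> y' \<Longrightarrow> q (x - y) = q (x' - y')"
  by (intro q_cong eqv_diff)

text \<open>The square roots of \<open>cis t\<close> are \<open>cis (t / 2)\<close> and its negative
  \<open>cis (t / 2 + pi)\<close>, so the averaging identity applies to \<open>cis (t / 2)\<close>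
  times \<open>b\<close>.\<close>

lemma resolvent_square:
  assumes b: "b \<in> corner e"
    and r: "corner_inverse e (e - \<iota> (cis (t / 2)) * b) r"
    and v: "corner_inverse e (e - \<iota> (cis (t / 2 + pi)) * b) v"
  shows "corner_inverse e (e - \<iota> (cis t) * (b * b)) (\<iota> (1/2) * (r + v))"
proof -
  let ?x = "\<iota> (cis (t / 2)) * b"
  have "cis (t / 2 + pi) = - cis (t / 2)" by (simp add: complex_eq_iff)
  then have v': "corner_inverse e (e + ?x) v" using v by (simp add: scalar_minus)
  have "?x * ?x = \<iota> (cis (t / 2)) * (b * \<iota> (cis (t / 2))) * b" by (simp only: mult.assoc)
  also have "b * \<iota> (cis (t / 2)) = \<iota> (cis (t / 2)) * b" using b by (simp add: scalar_comm)
  also have "\<iota> (cis (t / 2)) * (\<iota> (cis (t / 2)) * b) * b = \<iota> (cis (t / 2) * cis (t / 2)) * (b * b)"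
    by (simp only: scalar_mult mult.assoc)
  also have "cis (t / 2) * cis (t / 2) = cis t" by (simp add: cis_mult)
  finally have "?x * ?x = \<iota> (cis t) * (b * b)" .
  then show ?thesis using corner_inverse_average[OF _ r v'] b by simp
qed

text \<open>The resolvent of \<open>b\<^sup>2\<close> at angle \<open>t\<close> is an average of resolvents of \<open>b\<close> at angles moving
  with half the speed.\<close>

lemma resolvent_lipschitz_square:
  assumes b: "b \<in> corner e" and L: "resolvent_lipschitz b K"
  shows "resolvent_lipschitz (b * b) (K / 2)"
  unfolding resolvent_lipschitz_def
proof (intro conjI allI impI)
  fix t
  obtain r v where "corner_inverse e (e - \<iota> (cis (t / 2)) * b) r"
    "corner_inverse e (e - \<iota> (cis (t / 2 + pi)) * b) v"
    using L unfolding resolvent_lipschitz_def by blast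
  then show "\<exists>r. corner_inverse e (e - \<iota> (cis t) * (b * b)) r"
    using resolvent_square[OF b] by blast
next
  fix t u R V
  assume R: "corner_inverse e (e - \<iota> (cis t) * (b * b)) R"
    and V: "corner_inverse e (e - \<iota> (cis u) * (b * b)) V"
  obtain r v r' v' where r: "corner_inverse e (e - \<iota> (cis (t / 2)) * b) r"
      "corner_inverse e (e - \<iota> (cis (t / 2 + pi)) * b) v"
    and r': "corner_inverse e (e - \<iota> (cis (u / 2)) * b) r'"
      "corner_inverse e (e - \<iota> (cis (u / 2 + pi)) * b) v'"
    using L unfolding resolvent_lipschitz_def by meson
  have cl: "r \<in> A" "v \<in> A" "r' \<in> A" "v' \<in> A"
    using r r' corner_inverse_closed corner_simps(1) by blast+
  have "b * b \<in> A" using b by simp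
  then have "R \<approx> \<iota> (1/2) * (r + v)" "V \<approx> \<iota> (1/2) * (r' + v')"
    using corner_inverse_unique[OF R resolvent_square[OF b r]]
      corner_inverse_unique[OF V resolvent_square[OF b r']] by simp_all
  then have "q (R - V) = q (\<iota> (1/2) * (r + v) - \<iota> (1/2) * (r' + v'))" by (rule q_diff_cong)
  also have "\<iota> (1/2) * (r + v) - \<iota> (1/2) * (r' + v') = \<iota> (1/2) * ((r - r') + (v - v'))"
    by (simp add: algebra_simps)
  also have "q \<dots> = q ((r - r') + (v - v')) / 2" using cl by (simp add: q_scalar)
  also have "\<dots> \<le> (q (r - r') + q (v - v')) / 2" using cl by (simp add: q_triangle)
  \<comment> \<open>In both pairs the angles differ by half of \<open>t - u\<close>; this halves the
    constant.\<close>
  also have "q (r - r') \<le> K * \<bar>t / 2 - u / 2\<bar>"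
    using L r(1) r'(1) unfolding resolvent_lipschitz_def by blast
  also have "q (v - v') \<le> K * \<bar>(t / 2 + pi) - (u / 2 + pi)\<bar>"
    using L r(2) r'(2) unfolding resolvent_lipschitz_def by blast
  also have "(K * \<bar>t / 2 - u / 2\<bar> + K * \<bar>(t / 2 + pi) - (u / 2 + pi)\<bar>) / 2 = K / 2 * \<bar>t - u\<bar>"
    by (simp add: diff_divide_distrib [symmetric])
  finally show "q (R - V) \<le> K / 2 * \<bar>t - u\<bar>" by simp
qed

text \<open>The resolvents \<open>r\<close> and \<open>v\<close> at the antipodal points 1 and -1
  satisfy \<open>(e - b) * (r - v) * (e + b) = 2 b\<close>. Both outer factors have norm at most 2,
  hence \<open>2 \<le> 4 * q (r - v) \<le> 4 * pi * K\<close>.\<close>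

lemma resolvent_lipschitz_lower_bound:
  assumes b: "b \<in> corner e" "q b = 1" and L: "resolvent_lipschitz b K"
  shows "1 \<le> 2 * pi * K"
proof -
  obtain r v where "corner_inverse e (e - \<iota> (cis 0) * b) r" "corner_inverse e (e - \<iota> (cis pi) * b) v"
    and rv: "q (r - v) \<le> K * \<bar>0 - pi\<bar>"
    using L unfolding resolvent_lipschitz_def by metis
  then have r: "corner_inverse e (e - b) r" and v: "corner_inverse e (e + b) v"
    by (simp_all add: scalar_minus)
  have cl: "r \<in> corner e" "v \<in> corner e" "b \<in> A" using r v b by (simp_all add: corner_inverse_def)
  have ebl: "e - b \<in> corner e" "e + b \<in> corner e" using b by simp_all
  have "(e - b) * (r - v) * (e + b) = ((e - b) * r) * (e + b) - (e - b) * (v * (e + b))"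
    by (simp add: algebra_simps)
  also have "\<dots> \<approx> e * (e + b) - (e - b) * e"
    using r v b by (intro eqv_diff eqv_mult_left eqv_mult_right) (simp_all add: corner_inverse_def)
  also have "\<dots> \<approx> (e + b) - (e - b)" using ebl by (intro eqv_diff) simp_all
  also have "\<dots> = \<iota> 2 * b" using scalar_add[of 1 1] by (simp add: mult_2)
  finally have "q ((e - b) * (r - v) * (e + b)) = q (\<iota> 2 * b)" by (rule q_cong)
  then have "2 = q ((e - b) * (r - v) * (e + b))" using b cl by (simp add: q_scalar)
  also have "\<dots> \<le> q ((e - b) * (r - v)) * q (e + b)" using cl by (intro q_mult) simp_all
  also have "\<dots> \<le> (q (e - b) * q (r - v)) * q (e + b)"
    using cl by (intro mult_right_mono q_mult) simp_all
  also have "\<dots> \<le> (2 * q (r - v)) * 2"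
    using cl b q_triangle[of e b] q_triangle_diff[of e b] by (intro mult_mono) (simp_all add: q_e)
  finally show ?thesis using rv by (simp add: algebra_simps)
qed

text \<open>The C*-identity gives \<open>q (b\<^sup>2) = 1\<close>, so squaring can be iterated and drives the Lipschitz
  constant below the lower bound just obtained.\<close>

lemma not_resolvent_lipschitz:
  assumes "b \<in> corner e" "st b \<approx> b" "q b = 1"
  shows "\<not> resolvent_lipschitz b K"
proof
  assume L: "resolvent_lipschitz b K"
  have "\<exists>b. b \<in> corner e \<and> st b \<approx> b \<and> q b = 1 \<and> resolvent_lipschitz b (K / 2 ^ m)" for m
  proof (induction m)
    case 0 show ?case using assms L by (intro exI[of _ b]) simp
  next
    case (Suc m)
    then obtain b where b: "b \<in> corner e" "st b \<approx> b" "q b = 1" "resolvent_lipschitz b (K / 2 ^ m)"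
      by blast
    have "q (b * b) = q (st b * b)" using b by (intro q_cong eqv_mult_right eqv_sym[of "st b"]) simp_all
    then have "q (b * b) = 1" using b by (simp add: q_star_mult)
    moreover have "st (b * b) \<approx> b * b" using b by (simp add: star_mult eqv_mult)
    ultimately show ?case using resolvent_lipschitz_square[OF b(1,4)] b(1)
      by (intro exI[of _ "b * b"]) (simp add: mult.commute)
  qed
  then have "1 \<le> 2 * pi * (K / 2 ^ m)" for m using resolvent_lipschitz_lower_bound by blast
  then have "2 ^ m \<le> 2 * pi * K" for m by (simp add: field_simps)
  moreover obtain m where "2 * pi * K < 2 ^ m" using real_arch_pow[of 2] by auto
  ultimately show False by (meson not_le)
qed

text \<open>This is the resolvent identity \<open>r - v = (c - d) r b v\<close>, read modulo null
  elements.\<close>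

lemma resolvent_diff_bound:
  assumes b: "b \<in> corner e"
    and r: "corner_inverse e (e - \<iota> c * b) r" and v: "corner_inverse e (e - \<iota> d * b) v"
  shows "q (r - v) \<le> cmod (c - d) * (q r * q b * q v)"
proof -
  have cl: "r \<in> corner e" "v \<in> corner e" "b \<in> A" using r v b by (simp_all add: corner_inverse_def)
  have "r - v \<approx> r * e - e * v" using cl by (intro eqv_diff eqv_sym[of "r * e"] eqv_sym[of "e * v"]) simp_all
  also have "\<dots> \<approx> r * ((e - \<iota> d * b) * v) - (r * (e - \<iota> c * b)) * v"
    using r v by (intro eqv_diff eqv_mult_left eqv_mult_right eqv_sym[of _ e])
      (simp_all add: corner_inverse_def)
  also have "\<dots> = r * (\<iota> (c - d) * b * v)"
    using scalar_add[of "c - d" d] by (simp add: algebra_simps)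
  finally have "q (r - v) = q (r * (\<iota> (c - d) * b * v))" by (rule q_cong)
  also have "\<dots> \<le> q r * q (\<iota> (c - d) * (b * v))"
    using cl q_mult[of r "\<iota> (c - d) * (b * v)"] by (simp add: mult.assoc)
  also have "\<dots> = q r * (cmod (c - d) * q (b * v))" using cl by (simp add: q_scalar)
  also have "\<dots> \<le> q r * (cmod (c - d) * (q b * q v))"
    using cl by (intro mult_left_mono q_mult) simp_all
  finally show ?thesis by (simp add: algebra_simps)
qed

text \<open>The resolvent is locally bounded by the resolvent identity, hence bounded on the circle
  by compactness.\<close>

lemma resolvent_bounded:
  assumes b: "b \<in> corner e" and inv: "\<And>t. \<exists>r. corner_inverse e (e - \<iota> (cis t) * b) r"
  obtains C where "0 \<le> C" "\<And>t r. corner_inverse e (e - \<iota> (cis t) * b) r \<Longrightarrow> q r \<le> C"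
proof -
  define bd where "bd l u \<longleftrightarrow> (\<exists>C. \<forall>t r. l \<le> t \<and> t \<le> u \<and> corner_inverse e (e - \<iota> (cis t) * b) r \<longrightarrow> q r \<le> C)"
    for l u :: real
  have "bd 0 (2 * pi)"
  \<comment> \<open>Compactness of the interval enters as bisection: a property that passes to
    adjoining intervals and holds on all short ones around each point holds on the whole
    interval.\<close>
  proof (rule Bolzano)
    fix l m u assume "bd l m" "bd m u"
    then obtain C D where
      "\<And>t r. l \<le> t \<Longrightarrow> t \<le> m \<Longrightarrow> corner_inverse e (e - \<iota> (cis t) * b) r \<Longrightarrow> q r \<le> C"
      "\<And>t r. m \<le> t \<Longrightarrow> t \<le> u \<Longrightarrow> corner_inverse e (e - \<iota> (cis t) * b) r \<Longrightarrow> q r \<le> D"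
      unfolding bd_def by blast
    then show "bd l u" unfolding bd_def
      by (intro exI[of _ "max C D"]) (meson le_max_iff_disj linear)
  next
    fix x :: real
    obtain r where r: "corner_inverse e (e - \<iota> (cis x) * b) r" using inv by blast
    have rA: "r \<in> A" using corner_inverse_closed[OF r] by simp
    \<comment> \<open>For \<open>t\<close> within \<open>1 / (2 * (k + 1))\<close> of
      \<open>x\<close> the resolvent identity gives \<open>q (r - v) \<le> q v / 2\<close>, so
      \<open>q v \<le> 2 * q r\<close>. The summand 1 keeps the radius defined when
      \<open>k = 0\<close>.\<close>
    define k where "k = q r * q b"
    have k: "0 \<le> k" unfolding k_def using rA b by simp
    have "q v \<le> 2 * q r" if t: "\<bar>x - t\<bar> \<le> 1 / (2 * (k + 1))"
      and v: "corner_inverse e (e - \<iota> (cis t) * b) v" for t v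
    proof -
      have vA: "v \<in> A" using corner_inverse_closed[OF v] by simp
      have "\<bar>x - t\<bar> * k \<le> 1 / (2 * (k + 1)) * k" using t k by (intro mult_right_mono)
      also have "\<dots> \<le> 1 / 2" using k by (simp add: field_simps)
      finally have "cmod (cis x - cis t) * k \<le> 1 / 2"
        using mult_right_mono[OF cmod_cis_diff_le k, of x t] by linarith
      then have "cmod (cis x - cis t) * k * q v \<le> 1 / 2 * q v"
        using vA by (intro mult_right_mono) simp_all
      then have "q (r - v) \<le> q v / 2" using resolvent_diff_bound[OF b r v] by (simp add: k_def mult.assoc)
      moreover have "q v \<le> q r + q (r - v)" using q_triangle_diff[of r "r - v"] rA vA by simp
      ultimately show ?thesis by simp
    qed
    then have "bd l u" if "l \<le> x" "x \<le> u" "u - l < 1 / (2 * (k + 1))" for l u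
      using that unfolding bd_def by (intro exI[of _ "2 * q r"] allI impI) force
    then show "\<exists>d>0. \<forall>l u. l \<le> x \<and> x \<le> u \<and> u - l < d \<longrightarrow> bd l u"
      using k by (intro exI[of _ "1 / (2 * (k + 1))"]) simp
  qed simp
  then obtain C where
    C: "\<And>t r. 0 \<le> t \<Longrightarrow> t \<le> 2 * pi \<Longrightarrow> corner_inverse e (e - \<iota> (cis t) * b) r \<Longrightarrow> q r \<le> C"
    unfolding bd_def by blast
  have "q r \<le> max C 0" if "corner_inverse e (e - \<iota> (cis t) * b) r" for t r
  proof -
    \<comment> \<open>Any angle is moved into one period without changing
      \<open>cis t\<close>.\<close>
    obtain u where "0 \<le> u" "u < 2 * pi" "cos t = cos u" "sin t = sin u"
      using sincos_total_2pi[of "cos t" "sin t"] by auto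
    then show ?thesis using C[of u r] that by (simp add: cis.code le_max_iff_disj)
  qed
  then show ?thesis using that[of "max C 0"] by simp
qed

text \<open>After normalisation, \<open>not_resolvent_lipschitz\<close> forces some
  \<open>e - z b\<close> with \<open>|z| = 1\<close> to be non-invertible. Under \<open>div\<close>
  such an element is null, so \<open>b\<close> is a multiple of \<open>e\<close>.\<close>

lemma selfadjoint_corner_scalar:
  assumes div: "\<And>x. x \<in> corner e \<Longrightarrow> q x \<noteq> 0 \<Longrightarrow> \<exists>r. corner_inverse e x r"
    and b: "b \<in> corner e" "st b \<approx> b"
  shows "\<exists>c. b \<approx> \<iota> c * e"
proof (cases "q b = 0")
  case True
  then show ?thesis using b by (intro exI[of _ 0]) (simp add: eqv_0_iff)
next
  case False
  then have pos: "0 < q b" using b(1) by (simp add: order.strict_iff_order)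
  define a where "a = \<iota> (of_real (1 / q b)) * b"
  have a: "a \<in> corner e" using b by (simp add: a_def)
  have sa: "st a \<approx> a" unfolding a_def using b by (simp add: star_scale eqv_mult_left)
  have qa: "q a = 1" unfolding a_def using b pos by (simp add: q_scalar norm_divide)
  \<comment> \<open>If all inverses existed, a uniform bound \<open>C\<close> on them would make the
    resolvent Lipschitz with constant \<open>C * C\<close>.\<close>
  have "\<exists>t. \<not> (\<exists>r. corner_inverse e (e - \<iota> (cis t) * a) r)"
  proof (rule ccontr)
    assume "\<not> ?thesis"
    then have inv: "\<And>t. \<exists>r. corner_inverse e (e - \<iota> (cis t) * a) r" by blast
    then obtain C where C: "0 \<le> C" "\<And>t r. corner_inverse e (e - \<iota> (cis t) * a) r \<Longrightarrow> q r \<le> C"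
      using resolvent_bounded[OF a] by metis
    have "q (r - v) \<le> C * C * \<bar>t - u\<bar>" if r: "corner_inverse e (e - \<iota> (cis t) * a) r"
      and v: "corner_inverse e (e - \<iota> (cis u) * a) v" for t u r v
    proof -
      have cl: "r \<in> A" "v \<in> A" using r v corner_inverse_closed by (blast intro: corner_simps(1))+
      have "q (r - v) \<le> cmod (cis t - cis u) * (q r * q v)"
        using resolvent_diff_bound[OF a r v] qa by simp
      also have "\<dots> \<le> \<bar>t - u\<bar> * (C * C)"
        using C cl r v cmod_cis_diff_le by (intro mult_mono) simp_all
      finally show ?thesis by (simp add: mult.commute)
    qed
    then have "resolvent_lipschitz a (C * C)" using inv unfolding resolvent_lipschitz_def by blast
    then show False using not_resolvent_lipschitz[OF a sa qa] by blast
  qed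
  then obtain t where "q (e - \<iota> (cis t) * a) = 0" using div a by (metis corner_diff corner_scale e_in_corner)
  then have "\<iota> (cis t) * a \<approx> e" using a by (simp add: eqv_def q_diff_comm)
  \<comment> \<open>This factor undoes both the rotation by \<open>cis t\<close> and the
    normalisation of \<open>b\<close>.\<close>
  then have "\<iota> (of_real (q b) * cis (- t)) * (\<iota> (cis t) * a) \<approx> \<iota> (of_real (q b) * cis (- t)) * e"
    by (intro eqv_mult_left) simp_all
  moreover have "of_real (q b) * cis (- t) * cis t * of_real (1 / q b) = 1"
    using pos by (simp add: mult.assoc cis_mult)
  then have "\<iota> (of_real (q b) * cis (- t)) * (\<iota> (cis t) * a) = b"
    unfolding a_def by (simp only: mult.assoc[symmetric] scalar_mult[symmetric]) simp
  ultimately show ?thesis by auto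
qed

lemma compression_scalar:
  assumes div: "\<And>x. x \<in> corner e \<Longrightarrow> q x \<noteq> 0 \<Longrightarrow> \<exists>r. corner_inverse e x r" and b: "b \<in> A"
  shows "\<exists>c. e * b * e \<approx> \<iota> c * e"
proof -
  \<comment> \<open>The real and imaginary parts of \<open>b\<close>, with \<open>- \<i> / 2\<close>
    equal to \<open>1 / (2 i)\<close>. Their compressions by \<open>e\<close> are self-adjoint, so
    the previous lemma applies to each of them.\<close>
  define h where "h = \<iota> (1/2) * (b + st b)"
  define k where "k = \<iota> (- \<i> / 2) * (b - st b)"
  have hk: "h \<in> A" "k \<in> A" using b by (simp_all add: h_def k_def)
  have "st h = h" unfolding h_def using b by (simp add: star_scale star_add add.commute)
  moreover have "st k = k" unfolding k_def using b scalar_minus[of "\<i> / 2"]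
    by (simp add: star_scale star_diff algebra_simps)
  ultimately have st: "st (e * h * e) = e * h * e" "st (e * k * e) = e * k * e"
    using hk by (simp_all add: star_mult mult.assoc)
  have "\<iota> \<i> * k = \<iota> (1/2) * (b - st b)" unfolding k_def
    by (simp flip: mult.assoc scalar_mult)
  then have "h + \<iota> \<i> * k = \<iota> (1/2 + 1/2) * b" unfolding h_def scalar_add by (simp add: algebra_simps)
  then have "e * b * e = e * (h + \<iota> \<i> * k) * e" by simp
  also have "\<dots> = e * h * e + (e * \<iota> \<i>) * (k * e)" by (simp add: algebra_simps)
  also have "(e * \<iota> \<i>) * (k * e) = \<iota> \<i> * (e * k * e)" by (simp add: scalar_comm mult.assoc)
  finally have dec: "e * b * e = e * h * e + \<iota> \<i> * (e * k * e)" .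
  obtain c d where "e * h * e \<approx> \<iota> c * e" "e * k * e \<approx> \<iota> d * e"
    using selfadjoint_corner_scalar[OF div] st hk by (metis compression_in_corner corner_simps(1) eqv_refl)
  then have "e * b * e \<approx> \<iota> c * e + \<iota> \<i> * (\<iota> d * e)" unfolding dec
    by (intro eqv_add eqv_mult_left) simp_all
  also have "\<dots> = \<iota> (c + \<i> * d) * e" by (simp add: scalar_add scalar_mult distrib_right mult.assoc)
  finally show ?thesis by blast
qed

end

section \<open>From a minimal left ideal to a projection with scalar corner\<close>

lemma (in cstar_seminormed) minimal_projection:
  assumes L: "L \<subseteq> A" and L_mult: "\<And>a x. a \<in> A \<Longrightarrow> x \<in> L \<Longrightarrow> a * x \<in> L"
    and L_diff: "\<And>x y. x \<in> L \<Longrightarrow> y \<in> L \<Longrightarrow> x - y \<in> L"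
    and min: "\<And>x y. x \<in> L \<Longrightarrow> q x \<noteq> 0 \<Longrightarrow> y \<in> L \<Longrightarrow> \<exists>a\<in>A. y \<approx> a * x"
    and x: "x \<in> L" "q x \<noteq> 0"
  obtains e where "e \<in> A" "st e = e" "e * e \<approx> e" "q e \<noteq> 0" "\<And>y. y \<in> L \<Longrightarrow> y * e \<approx> y"
    "\<And>b. b \<in> A \<Longrightarrow> \<exists>c. e * b * e \<approx> \<iota> c * e"
proof -
  have LA [simp]: "y \<in> A" if "y \<in> L" for y using L that by blast
  define h where "h = st x * x"
  have h: "h \<in> L" "st h = h" "q h \<noteq> 0" and hh: "q (h * h) \<noteq> 0"
  proof -
    show "h \<in> L" unfolding h_def using x L_mult by simp
    show sth: "st h = h" unfolding h_def using x by (simp add: star_mult)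
    show qh: "q h \<noteq> 0" unfolding h_def using x by (simp add: q_star_mult)
    show "q (h * h) \<noteq> 0" using q_star_mult[of h] sth qh \<open>h \<in> L\<close> by simp
  qed
  \<comment> \<open>Right multiplication by \<open>h\<close> is injective on \<open>L\<close> modulo
    null elements: a non-null \<open>z\<close> generates \<open>h\<close>, so \<open>z * h\<close>
    null would make \<open>h * h\<close> null.\<close>
  have null: "z \<approx> 0" if z: "z \<in> L" "z * h \<approx> 0" for z
  proof (rule ccontr)
    assume "\<not> z \<approx> 0"
    then have "q z \<noteq> 0" using z by (simp add: eqv_0_iff)
    then obtain a where a: "a \<in> A" "h \<approx> a * z" using min z h by blast
    then have "h * h \<approx> a * z * h" using h by (simp add: eqv_mult_right)
    also have "a * z * h = a * (z * h)" by (simp add: mult.assoc)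
    also have "\<dots> \<approx> a * 0" using a z by (intro eqv_mult_left)
    finally show False using hh by (simp add: eqv_0_iff)
  qed
  have "h * h \<in> L" using h L_mult by simp
  then obtain a where a: "a \<in> A" "h \<approx> a * (h * h)" using min hh h by blast
  define g where "g = a * h"
  have g: "g \<in> L" "g * h \<approx> h" using a h L_mult eqv_sym[OF a(2)] by (simp_all add: g_def mult.assoc)
  \<comment> \<open>Since \<open>g * h \<approx> h\<close>, the element \<open>y * g - y\<close> of
    \<open>L\<close> is annihilated by \<open>h\<close> and is therefore null: \<open>g\<close> is a
    right identity of \<open>L\<close>.\<close>
  have yg: "y * g \<approx> y" if y: "y \<in> L" for y
  proof -
    have "y * (g * h) - y * h \<approx> y * h - y * h" using g h y by (intro eqv_diff eqv_mult_left) simp_all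
    then have "(y * g - y) * h \<approx> 0" by (simp add: left_diff_distrib mult.assoc)
    then have "y * g - y \<approx> 0" using g y by (auto intro: null[OF L_diff[OF L_mult]])
    then show ?thesis using y g eqv_iff_diff[of "y * g" y] by simp
  qed
  \<comment> \<open>The adjoint of \<open>h * g \<approx> h\<close>. It shows that
    \<open>st g * g\<close> and \<open>g\<close> agree after right multiplication by
    \<open>h\<close>, hence modulo null elements.\<close>
  have gs: "st g * h \<approx> h"
    using eqv_star[OF yg[OF h(1)]] h g by (simp add: star_mult)
  have "st g * (g * h) - g * h \<approx> st g * h - h"
    using g h by (intro eqv_diff eqv_mult_left g(2)) simp_all
  also have "\<dots> \<approx> h - h" using gs h by (intro eqv_diff) simp_all
  finally have "(st g * g - g) * h \<approx> 0" by (simp add: left_diff_distrib mult.assoc)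
  then have "st g * g - g \<approx> 0" using g by (auto intro: null[OF L_diff[OF L_mult]])
  \<comment> \<open>The representative \<open>st g * g\<close> of the class of \<open>g\<close> is
    self-adjoint on the nose.\<close>
  define e where "e = st g * g"
  have eL: "e \<in> L" unfolding e_def using g L_mult by simp
  then have eA [simp]: "e \<in> A" by simp
  have eg: "e \<approx> g" using \<open>st g * g - g \<approx> 0\<close> g eqv_iff_diff[of e g] by (simp add: e_def)
  have ste: "st e = e" unfolding e_def using g by (simp add: star_mult)
  have ye: "y * e \<approx> y" if "y \<in> L" for y
    using eqv_mult_left[OF LA[OF that] eg] yg[OF that] by (rule eqv_trans)
  have qe: "q e \<noteq> 0"
  proof
    assume "q e = 0"
    then have "h * e \<approx> h * 0" using h by (intro eqv_mult_left) (simp_all add: eqv_0_iff)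
    then have "h \<approx> 0" using eqv_trans[OF eqv_sym[OF ye[OF h(1)]]] by simp
    then show False using h by (simp add: eqv_0_iff)
  qed
  interpret P: cstar_seminormed_projection A \<iota> st q e
    using ste ye[OF eL] qe by unfold_locales simp_all
  \<comment> \<open>The nonzero element \<open>y * e\<close> of \<open>L\<close> generates
    \<open>e\<close>, and compressing the coefficient by \<open>e\<close> brings it into the
    corner.\<close>
  have left: "\<exists>r \<in> corner e. r * y \<approx> e" if y: "y \<in> corner e" "q y \<noteq> 0" for y
  proof -
    have "q (y * e) \<noteq> 0" using y q_cong[of "y * e" y] by simp
    moreover have "y * e \<in> L" using y eL L_mult by simp
    ultimately obtain c where c: "c \<in> A" "e \<approx> c * (y * e)" using min eL by blast
    have "e * c * e * y = e * c * (e * y)" by (simp add: mult.assoc)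
    also have "\<dots> \<approx> e * c * (y * e)"
      using c y by (intro eqv_mult_left eqv_trans[OF P.corner_simps(2) eqv_sym]) simp_all
    also have "\<dots> = e * (c * (y * e))" by (simp add: mult.assoc)
    also have "\<dots> \<approx> e * e" using c by (intro eqv_mult_left eqv_sym[of e]) simp_all
    also have "\<dots> \<approx> e" by (rule P.e_idem)
    finally show ?thesis using P.compression_in_corner[OF c(1)] by blast
  qed
  \<comment> \<open>A left inverse \<open>r\<close> of \<open>y\<close> has itself a left inverse
    \<open>v\<close>. Then \<open>v = v (r y) = (v r) y = y\<close>, so \<open>r\<close> is
    two-sided.\<close>
  have div: "\<exists>r. corner_inverse e y r" if y: "y \<in> corner e" "q y \<noteq> 0" for y
  proof -
    obtain r where r: "r \<in> corner e" "r * y \<approx> e" using left y by blast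
    have "q r \<noteq> 0"
    proof
      assume "q r = 0"
      then have "r * y \<approx> 0 * y" using r y by (intro eqv_mult_right) (simp_all add: eqv_0_iff)
      then have "e \<approx> 0" using eqv_trans[OF eqv_sym[OF r(2)]] by simp
      then show False using qe by (simp add: eqv_0_iff)
    qed
    then obtain v where v: "v \<in> corner e" "v * r \<approx> e" using left r by blast
    have "y \<approx> e * y" using y by (intro eqv_sym[of "e * y"]) simp
    also have "e * y \<approx> (v * r) * y" using v y by (intro eqv_mult_right eqv_sym[of _ e]) simp_all
    also have "\<dots> = v * (r * y)" by (simp add: mult.assoc)
    also have "\<dots> \<approx> v * e" using v r by (intro eqv_mult_left) simp_all
    also have "\<dots> \<approx> v" using v by simp
    finally have "y * r \<approx> v * r" using r by (intro eqv_mult_right) simp_all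
    then show ?thesis using r eqv_trans[OF _ v(2)] unfolding corner_inverse_def by blast
  qed
  show ?thesis
    using that[OF eA ste P.e_idem qe ye] P.compression_scalar[OF div] by blast
qed

section \<open>Minimal left ideals in quotient algebras\<close>

lemma ring_extend:
  assumes "ring R" shows "ring (ring.extend R m)"
proof -
  interpret ring R by fact
  show ?thesis
  proof (rule ringI)
    show "abelian_group (ring.extend R m)"
      by (rule abelian_groupI) (auto simp: ring.defs a_ac intro: l_neg a_inv_closed)
    show "Group.monoid (ring.extend R m)"
      by (rule monoidI) (auto simp: ring.defs m_assoc)
  qed (auto simp: ring.defs l_distr r_distr)
qed

locale unital_algebra = ring R for R :: "(complex, 'b, 'm) module_scheme" (structure) +
  assumes smult_closed [simp]: "x \<in> carrier R \<Longrightarrow> c \<odot> x \<in> carrier R"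
    and smult_eq: "x \<in> carrier R \<Longrightarrow> c \<odot> x = (c \<odot> \<one>) \<otimes> x"
begin

text \<open>Scaling by \<open>c\<close> is left multiplication by \<open>c \<odot> \<one>\<close>,
  so ring-theoretic left ideals are closed under scalars.\<close>

lemma left_ideal_iff:
  "left_ideal L R \<longleftrightarrow> additive_subgroup L R \<and> (\<forall>a\<in>carrier R. \<forall>x\<in>L. a \<otimes> x \<in> L)"
proof -
  have "c \<odot> x \<in> L" if "additive_subgroup L R" "\<forall>a\<in>carrier R. \<forall>x\<in>L. a \<otimes> x \<in> L" "x \<in> L" for c x
    using that smult_eq[of x c] additive_subgroup.a_Hcarr[OF that(1,3)] by simp
  then show ?thesis unfolding left_ideal_def by blast
qed

lemma left_idealI:
  assumes "L \<subseteq> carrier R" "\<zero> \<in> L" "\<And>x y. x \<in> L \<Longrightarrow> y \<in> L \<Longrightarrow> x \<oplus> y \<in> L"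
    and mult: "\<And>a x. a \<in> carrier R \<Longrightarrow> x \<in> L \<Longrightarrow> a \<otimes> x \<in> L"
  shows "left_ideal L R"
proof -
  have "\<ominus> x \<in> L" if "x \<in> L" for x
    using mult[of "\<ominus> \<one>" x] that assms(1) by (auto simp: l_minus)
  then show ?thesis unfolding left_ideal_iff
    using assms by (auto intro!: additive_subgroup.intro add.subgroupI simp flip: a_inv_def)
qed

text \<open>By \<open>inv\<close>, a nonzero left ideal inside contains \<open>e\<close>, and then
  every \<open>y = y \<otimes> e\<close>.\<close>

lemma minimal_left_ideal_idempotent:
  assumes e: "e \<in> carrier R" "e \<noteq> \<zero>" "e \<otimes> e = e"
    and inv: "\<And>y. y \<in> carrier R \<Longrightarrow> y \<otimes> e = y \<Longrightarrow> y \<noteq> \<zero> \<Longrightarrow> \<exists>z\<in>carrier R. z \<otimes> y = e"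
  shows "minimal_left_ideal {y \<in> carrier R. y \<otimes> e = y} R" (is "minimal_left_ideal ?L R")
  unfolding minimal_left_ideal_def
proof (intro conjI allI impI)
  show "left_ideal ?L R" using e by (intro left_idealI) (auto simp: l_distr m_assoc)
  show "?L \<noteq> {\<zero>}" using e by blast
  fix J assume J: "left_ideal J R \<and> J \<subseteq> ?L"
  then interpret J: additive_subgroup J R by (simp add: left_ideal_def)
  have mult: "a \<otimes> x \<in> J" if "a \<in> carrier R" "x \<in> J" for a x using J that by (simp add: left_ideal_def)
  show "J = {\<zero>} \<or> J = ?L"
  proof (cases "J = {\<zero>}")
    case False
    then obtain y where "y \<in> J" "y \<noteq> \<zero>" using J.zero_closed by blast
    then obtain z where "z \<in> carrier R" "z \<otimes> y = e" using inv[of y] J by blast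
    then have eJ: "e \<in> J" using mult[OF _ \<open>y \<in> J\<close>] by metis
    have "x \<in> J" if "x \<in> ?L" for x using that mult[of x, OF _ eJ] by simp
    then have "?L \<subseteq> J" by blast
    then show ?thesis using J by blast
  qed simp
qed

lemma minimal_left_ideal_carrier: "minimal_left_ideal L R \<Longrightarrow> x \<in> L \<Longrightarrow> x \<in> carrier R"
  unfolding minimal_left_ideal_def left_ideal_def by (meson additive_subgroup.a_Hcarr)

lemma minimal_left_ideal_zero: "minimal_left_ideal L R \<Longrightarrow> \<zero> \<in> L"
  unfolding minimal_left_ideal_def left_ideal_def by (meson additive_subgroup.zero_closed)

section \<open>The socle as a set of finite sums\<close>

lemma Soc_zero: "\<zero> \<in> Soc R"
  unfolding Soc_def by (rule CollectI, rule exI[of _ "\<lambda>_. \<zero>"], rule exI[of _ "{}"]) simp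

lemma minimal_left_ideal_subset_Soc:
  assumes "minimal_left_ideal L R" "x \<in> L" shows "x \<in> Soc R"
proof -
  have "finsum R (\<lambda>_. x) {L} = x"
    using minimal_left_ideal_carrier[OF assms] by (subst finsum_insert) auto
  then show ?thesis unfolding Soc_def using assms
    by (intro CollectI exI[of _ "\<lambda>_. x"] exI[of _ "{L}"]) simp
qed

text \<open>The definition of \<open>Soc\<close> allows one summand per ideal. Both families are
  extended by zero to the union of their index sets and added ideal by ideal.\<close>

lemma Soc_add:
  assumes "x \<in> Soc R" "y \<in> Soc R" shows "x \<oplus> y \<in> Soc R"
proof -
  obtain f F where F: "finite F" "\<And>L. L \<in> F \<Longrightarrow> minimal_left_ideal L R \<and> f L \<in> L" "x = finsum R f F"
    using assms(1) unfolding Soc_def by auto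
  obtain g G where G: "finite G" "\<And>L. L \<in> G \<Longrightarrow> minimal_left_ideal L R \<and> g L \<in> L" "y = finsum R g G"
    using assms(2) unfolding Soc_def by auto
  define f' where "f' L = (if L \<in> F then f L else \<zero>)" for L
  define g' where "g' L = (if L \<in> G then g L else \<zero>)" for L
  have f': "f' L \<in> L" and g': "g' L \<in> L" and L: "minimal_left_ideal L R" if "L \<in> F \<union> G" for L
    using F(2)[of L] G(2)[of L] that minimal_left_ideal_zero[of L] by (auto simp: f'_def g'_def)
  have car: "f' \<in> F \<union> G \<rightarrow> carrier R" "g' \<in> F \<union> G \<rightarrow> carrier R"
    using f' g' L minimal_left_ideal_carrier by blast+
  have fc: "f L \<in> carrier R" if "L \<in> F" for L using F(2)[OF that] minimal_left_ideal_carrier by blast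
  have gc: "g L \<in> carrier R" if "L \<in> G" for L using G(2)[OF that] minimal_left_ideal_carrier by blast
  have "x = finsum R f' F" unfolding F(3) using fc
    by (intro finsum_cong') (auto simp: f'_def)
  also have "\<dots> = finsum R f' (F \<union> G)" using F(1) G(1) car
    by (intro add.finprod_mono_neutral_cong_left) (auto simp: f'_def)
  finally have x: "x = finsum R f' (F \<union> G)" .
  have "y = finsum R g' G" unfolding G(3) using gc
    by (intro finsum_cong') (auto simp: g'_def)
  also have "\<dots> = finsum R g' (F \<union> G)" using F(1) G(1) car
    by (intro add.finprod_mono_neutral_cong_left) (auto simp: g'_def)
  finally have "x \<oplus> y = finsum R (\<lambda>L. f' L \<oplus> g' L) (F \<union> G)" using x car by (simp add: finsum_addf)
  moreover have "f' L \<oplus> g' L \<in> L" if "L \<in> F \<union> G" for L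
    using f'[OF that] g'[OF that] L[OF that] additive_subgroup.a_closed[of L R]
    by (simp add: minimal_left_ideal_def left_ideal_def)
  moreover have "finite (F \<union> G)" using F(1) G(1) by simp
  ultimately show ?thesis unfolding Soc_def using L by blast
qed

lemma Soc_induct:
  assumes "x \<in> Soc R" and zero: "P \<zero>"
    and add: "\<And>L x y. minimal_left_ideal L R \<Longrightarrow> x \<in> L \<Longrightarrow> y \<in> carrier R \<Longrightarrow> P y \<Longrightarrow> P (x \<oplus> y)"
  shows "P x"
proof -
  obtain f F where F: "finite F" "\<forall>L\<in>F. minimal_left_ideal L R \<and> f L \<in> L" and x: "x = finsum R f F"
    using assms(1) unfolding Soc_def by blast
  show ?thesis unfolding x using F
  proof (induction F)
    case (insert L F)
    have "f L \<in> carrier R" "f \<in> F \<rightarrow> carrier R"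
      using insert.prems minimal_left_ideal_carrier by blast+
    then show ?case using insert add[of L "f L" "finsum R f F"] by simp
  qed (simp add: zero)
qed

end

text \<open>The record of the completion also carries an adjoint and a norm, which the socle does
  not see.\<close>

lemma Soc_module_extend: "Soc (module.extend M a) = Soc M"
  by (simp add: Soc_def minimal_left_ideal_def left_ideal_def additive_subgroup_def
    finsum_def finprod_def subgroup_def m_inv_def module.defs)

locale unital_algebra_ideal = unital_algebra R + ideal I R for I and R :: "(complex, 'b, 'm) module_scheme" (structure)
begin

section \<open>Computing in a quotient algebra by representatives\<close>

abbreviation Q where "Q \<equiv> alg_quot R I"

lemma quot_simps:
  "x \<in> carrier R \<Longrightarrow> y \<in> carrier R \<Longrightarrow> (I +> x) \<oplus>\<^bsub>Q\<^esub> (I +> y) = I +> (x \<oplus> y)"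
  "x \<in> carrier R \<Longrightarrow> y \<in> carrier R \<Longrightarrow> (I +> x) \<otimes>\<^bsub>Q\<^esub> (I +> y) = I +> (x \<otimes> y)"
  "\<one>\<^bsub>Q\<^esub> = I +> \<one>" "\<zero>\<^bsub>Q\<^esub> = I +> \<zero>"
  "carrier Q = (\<lambda>x. I +> x) ` carrier R"
  using a_coset_add_zero[OF a_subset]
  by (auto simp: alg_quot_def ring.defs module.defs FactRing_def a_rcos_sum rcoset_mult_add A_RCOSETS_def')

lemma quot_eq_iff:
  "x \<in> carrier R \<Longrightarrow> y \<in> carrier R \<Longrightarrow> I +> x = I +> y \<longleftrightarrow> x \<ominus> y \<in> I"
  using quotient_eq_iff_same_a_r_cos[OF is_ideal] by simp

lemma quot_rep:
  assumes "x \<in> carrier R" "y \<in> I +> x" shows "y \<in> carrier R" "y \<ominus> x \<in> I"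
proof -
  show y: "y \<in> carrier R" using assms a_r_coset_subset_G[OF a_subset] by blast
  show "y \<ominus> x \<in> I" using a_repr_independence[OF assms(2,1) a_subgroup] quot_eq_iff[OF y assms(1)] by simp
qed

lemma quot_rep_self: "x \<in> carrier R \<Longrightarrow> x \<in> I +> x"
  by (rule a_rcos_self)

text \<open>The scalar multiple of a coset is a union over all its representatives; it is a single
  coset because \<open>I\<close> is closed under multiplication by
  \<open>c \<odot> \<one>\<close>.\<close>

lemma quot_smult:
  assumes x: "x \<in> carrier R" shows "c \<odot>\<^bsub>Q\<^esub> (I +> x) = I +> (c \<odot> x)"
proof -
  have "I +> (c \<odot> y) = I +> (c \<odot> x)" if "y \<in> I +> x" for y
  proof -
    have y: "y \<in> carrier R" "y \<ominus> x \<in> I" using quot_rep[OF x that] by auto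
    then have "(c \<odot> \<one>) \<otimes> (y \<ominus> x) \<in> I" using I_l_closed by simp
    then have "c \<odot> y \<ominus> c \<odot> x \<in> I"
      using x y by (subst (1 2) smult_eq) (simp_all add: minus_eq r_distr r_minus)
    then show ?thesis using x y by (simp add: quot_eq_iff)
  qed
  moreover have "c \<odot>\<^bsub>Q\<^esub> (I +> x) = (\<Union>y\<in>I +> x. I +> (c \<odot> y))"
    by (simp add: alg_quot_def ring.defs module.defs)
  ultimately show ?thesis using quot_rep_self[OF x] by blast
qed

sublocale quot: unital_algebra Q
proof (intro unital_algebra.intro unital_algebra_axioms.intro)
  show "ring Q" unfolding alg_quot_def by (intro ring_extend quotient_is_ring)
next
  fix c X assume "X \<in> carrier Q"
  then obtain x where x: "x \<in> carrier R" "X = I +> x" by (auto simp: quot_simps)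
  then show "c \<odot>\<^bsub>Q\<^esub> X \<in> carrier Q" by (simp add: quot_smult quot_simps)
  show "c \<odot>\<^bsub>Q\<^esub> X = (c \<odot>\<^bsub>Q\<^esub> \<one>\<^bsub>Q\<^esub>) \<otimes>\<^bsub>Q\<^esub> X"
    using x smult_eq[of x c] by (simp add: quot_smult quot_simps)
qed

text \<open>The cosets of the multiples of \<open>x\<close> form a nonzero left ideal inside
  \<open>L\<close>, so by minimality they exhaust \<open>L\<close>.\<close>

lemma minimal_left_ideal_generates:
  assumes L: "minimal_left_ideal L Q" and x: "x \<in> carrier R" "I +> x \<in> L" "x \<notin> I"
    and y: "y \<in> carrier R" "I +> y \<in> L"
  shows "\<exists>a\<in>carrier R. y \<ominus> a \<otimes> x \<in> I"
proof -
  let ?J = "(\<lambda>a. I +> (a \<otimes> x)) ` carrier R"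
  have "left_ideal ?J Q"
  proof (rule quot.left_idealI)
    show "?J \<subseteq> carrier Q" using x by (auto simp: quot_simps)
    show "\<zero>\<^bsub>Q\<^esub> \<in> ?J" using x by (intro image_eqI[of _ _ \<zero>]) (simp_all add: quot_simps)
  next
    fix u v assume "u \<in> ?J" "v \<in> ?J"
    then obtain a b where "a \<in> carrier R" "b \<in> carrier R" "u = I +> (a \<otimes> x)" "v = I +> (b \<otimes> x)"
      by blast
    then show "u \<oplus>\<^bsub>Q\<^esub> v \<in> ?J"
      using x by (intro image_eqI[of _ _ "a \<oplus> b"]) (simp_all add: quot_simps l_distr)
  next
    fix b u assume "b \<in> carrier Q" "u \<in> ?J"
    then obtain a b' where "a \<in> carrier R" "b' \<in> carrier R" "u = I +> (a \<otimes> x)" "b = I +> b'"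
      by (auto simp: quot_simps)
    then show "b \<otimes>\<^bsub>Q\<^esub> u \<in> ?J"
      using x by (intro image_eqI[of _ _ "b' \<otimes> a"]) (simp_all add: quot_simps m_assoc)
  qed
  moreover have "?J \<subseteq> L"
  proof
    fix u assume "u \<in> ?J"
    then obtain a where a: "a \<in> carrier R" "u = (I +> a) \<otimes>\<^bsub>Q\<^esub> (I +> x)" using x by (auto simp: quot_simps)
    then have "I +> a \<in> carrier Q" by (simp add: quot_simps)
    then show "u \<in> L" using L x a unfolding minimal_left_ideal_def left_ideal_def by blast
  qed
  moreover have "I +> x \<in> ?J" using x by (intro image_eqI[of _ _ \<one>]) simp_all
  moreover have "I +> x \<noteq> \<zero>\<^bsub>Q\<^esub>" using x by (simp add: quot_simps quot_eq_iff minus_eq)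
  ultimately have "?J = L" using L unfolding minimal_left_ideal_def by blast
  then obtain a where "a \<in> carrier R" "I +> y = I +> (a \<otimes> x)" using y by blast
  then show ?thesis using x y by (auto simp: quot_eq_iff)
qed

end

section \<open>The socle of the completion\<close>

text \<open>A bridge between the two formalisms: estimates are proved in a type-class ring, whereas
  ideals, quotients and socles are stated for records.\<close>

definition concrete_algebra :: "'b::ring_1 set \<Rightarrow> (complex \<Rightarrow> 'b) \<Rightarrow> (complex, 'b) module" where
  "concrete_algebra A \<iota> = \<lparr>carrier = A, mult = (*), one = 1, zero = 0, add = (+), smult = \<lambda>c x. \<iota> c * x\<rparr>"

lemma concrete_algebra_simps [simp]:
  "carrier (concrete_algebra A \<iota>) = A" "mult (concrete_algebra A \<iota>) = (*)"
  "one (concrete_algebra A \<iota>) = 1" "zero (concrete_algebra A \<iota>) = 0"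
  "add (concrete_algebra A \<iota>) = (+)" "smult (concrete_algebra A \<iota>) c x = \<iota> c * x"
  by (simp_all add: concrete_algebra_def)

context cstar_seminormed begin

section \<open>Cauchy and null sequences\<close>

definition cauchy :: "(nat \<Rightarrow> 'b) \<Rightarrow> bool" where
  "cauchy u \<longleftrightarrow> (\<forall>n. u n \<in> A) \<and> (\<forall>d>0. \<exists>K. \<forall>m\<ge>K. \<forall>n\<ge>K. q (u m - u n) < d)"

definition null :: "(nat \<Rightarrow> 'b) \<Rightarrow> bool" where
  "null u \<longleftrightarrow> (\<forall>n. u n \<in> A) \<and> (\<lambda>n. q (u n)) \<longlonglongrightarrow> 0"

lemma cauchy_closed [simp]: "cauchy u \<Longrightarrow> u n \<in> A"
  by (simp add: cauchy_def)

lemma null_closed [simp]: "null u \<Longrightarrow> u n \<in> A"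
  by (simp add: null_def)

lemma cauchy_const [simp]: "x \<in> A \<Longrightarrow> cauchy (\<lambda>_. x)"
  by (simp add: cauchy_def)

lemma null_const_iff: "null (\<lambda>_. x) \<longleftrightarrow> x \<in> A \<and> q x = 0"
  using LIMSEQ_unique[OF tendsto_const, of "q x" 0] by (auto simp: null_def)

lemma cauchy_bounded:
  assumes "cauchy u" obtains B where "0 < B" "\<And>n. q (u n) \<le> B"
proof -
  obtain K where K: "\<And>m n. m \<ge> K \<Longrightarrow> n \<ge> K \<Longrightarrow> q (u m - u n) < 1"
    using assms unfolding cauchy_def by (meson zero_less_one)
  define B where "B = (\<Sum>n\<le>K. q (u n)) + 1"
  have le: "q (u n) \<le> (\<Sum>n\<le>K. q (u n))" if "n \<le> K" for n
    using assms that by (intro member_le_sum) auto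
  have "q (u n) \<le> B" for n
  proof (cases "n \<le> K")
    case True then show ?thesis using le[of n] by (simp add: B_def)
  next
    case False
    then have "q (u n - u K) < 1" using K by simp
    then show ?thesis using q_triangle[of "u n - u K" "u K"] le[of K] assms by (simp add: B_def)
  qed
  moreover have "0 < B" unfolding B_def using assms by (simp add: add_nonneg_pos sum_nonneg)
  ultimately show ?thesis using that by blast
qed

text \<open>A common criterion for sums, products and adjoints. Two controlling sequences serve
  binary operations, and \<open>B\<close> absorbs the bounds on the factors of a product.\<close>

lemma cauchy_dominated:
  assumes "\<And>n. u n \<in> A" "cauchy v" "cauchy w" "0 < B"
    and le: "\<And>m n. q (u m - u n) \<le> B * q (v m - v n) + B * q (w m - w n)"
  shows "cauchy u"
  unfolding cauchy_def
proof (intro conjI allI impI)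
  fix d :: real assume "0 < d"
  then have d: "0 < d / (2 * B)" using assms by simp
  obtain K L where K: "\<And>m n. m \<ge> K \<Longrightarrow> n \<ge> K \<Longrightarrow> q (v m - v n) < d / (2 * B)"
    and L: "\<And>m n. m \<ge> L \<Longrightarrow> n \<ge> L \<Longrightarrow> q (w m - w n) < d / (2 * B)"
    using d assms(2,3) unfolding cauchy_def by meson
  have "q (u m - u n) < d" if "m \<ge> max K L" "n \<ge> max K L" for m n
  proof -
    have "q (v m - v n) < d / (2 * B)" "q (w m - w n) < d / (2 * B)" using K L that by simp_all
    then have "B * q (v m - v n) < B * (d / (2 * B))" "B * q (w m - w n) < B * (d / (2 * B))"
      using assms(4) by (simp_all only: mult_strict_left_mono)
    then show ?thesis using le[of m n] assms(4) by simp
  qed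
  then show "\<exists>K. \<forall>m\<ge>K. \<forall>n\<ge>K. q (u m - u n) < d" by blast
qed (use assms in simp)

lemma cauchy_add [simp]: "cauchy u \<Longrightarrow> cauchy v \<Longrightarrow> cauchy (\<lambda>n. u n + v n)"
proof (rule cauchy_dominated[of _ u v 1])
  fix m n assume "cauchy u" "cauchy v"
  then show "q (u m + v m - (u n + v n)) \<le> 1 * q (u m - u n) + 1 * q (v m - v n)"
    using q_triangle[of "u m - u n" "v m - v n"] by (simp add: add_diff_add)
qed simp_all

lemma cauchy_mult [simp]:
  assumes u: "cauchy u" and v: "cauchy v" shows "cauchy (\<lambda>n. u n * v n)"
proof -
  obtain B D where B: "0 < B" "\<And>n. q (u n) \<le> B" and D: "0 < D" "\<And>n. q (v n) \<le> D"
    using cauchy_bounded[OF u] cauchy_bounded[OF v] by metis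
  show ?thesis
  proof (rule cauchy_dominated[OF _ u v, of _ "max B D"])
    fix m n
    have "u m * v m - u n * v n = (u m - u n) * v m + u n * (v m - v n)" by (simp add: algebra_simps)
    then have "q (u m * v m - u n * v n) \<le> q ((u m - u n) * v m) + q (u n * (v m - v n))"
      using q_triangle u v by simp
    also have "\<dots> \<le> q (u m - u n) * q (v m) + q (u n) * q (v m - v n)"
      using u v by (intro add_mono q_mult) simp_all
    also have "\<dots> \<le> q (u m - u n) * max B D + max B D * q (v m - v n)"
      using u v B(2)[of n] D(2)[of m] by (intro add_mono mult_left_mono mult_right_mono) simp_all
    finally show "q (u m * v m - u n * v n) \<le> max B D * q (u m - u n) + max B D * q (v m - v n)"
      by (simp add: mult.commute)
  qed (use u v B in simp_all)
qed

lemma cauchy_minus [simp]: "cauchy u \<Longrightarrow> cauchy (\<lambda>n. - u n)"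
  using cauchy_mult[of "\<lambda>_. -1" u] by simp

lemma cauchy_diff [simp]: "cauchy u \<Longrightarrow> cauchy v \<Longrightarrow> cauchy (\<lambda>n. u n - v n)"
  using cauchy_add[of u "\<lambda>n. - v n"] by simp

lemma cauchy_star [simp]: "cauchy u \<Longrightarrow> cauchy (\<lambda>n. st (u n))"
proof (rule cauchy_dominated[of _ u "\<lambda>_. 0" 1])
  fix m n assume "cauchy u"
  then show "q (st (u m) - st (u n)) \<le> 1 * q (u m - u n) + 1 * q (0 - 0)"
    using q_star[of "u m - u n"] by (simp add: star_diff)
qed simp_all

lemma null_dominated:
  assumes "\<And>n. u n \<in> A" "f \<longlonglongrightarrow> 0" "\<And>n. q (u n) \<le> f n" shows "null u"
  unfolding null_def
proof (intro conjI allI)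
  show "(\<lambda>n. q (u n)) \<longlonglongrightarrow> 0"
    by (rule tendsto_sandwich[OF _ _ tendsto_const assms(2)]) (use assms in simp_all)
qed (use assms in simp)

lemma null_add:
  assumes "null u" "null v" shows "null (\<lambda>n. u n + v n)"
proof (rule null_dominated)
  show "(\<lambda>n. q (u n) + q (v n)) \<longlonglongrightarrow> 0"
    using tendsto_add[of "\<lambda>n. q (u n)" 0 sequentially "\<lambda>n. q (v n)" 0] assms by (simp add: null_def)
qed (use assms in \<open>simp_all add: q_triangle\<close>)

lemma null_mult_left:
  assumes "cauchy u" "null v" shows "null (\<lambda>n. u n * v n)"
proof -
  obtain B where B: "0 < B" "\<And>n. q (u n) \<le> B" using cauchy_bounded[OF assms(1)] by blast
  show ?thesis
  proof (rule null_dominated)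
    show "(\<lambda>n. B * q (v n)) \<longlonglongrightarrow> 0"
      using tendsto_mult_right_zero[of "\<lambda>n. q (v n)"] assms by (simp add: null_def)
    fix n
    have "q (u n * v n) \<le> q (u n) * q (v n)" using assms by (simp add: q_mult)
    also have "\<dots> \<le> B * q (v n)" using B(2) assms by (intro mult_right_mono) simp_all
    finally show "q (u n * v n) \<le> B * q (v n)" .
  qed (use assms in simp)
qed

lemma null_mult_right:
  assumes "cauchy u" "null v" shows "null (\<lambda>n. v n * u n)"
proof -
  obtain B where B: "0 < B" "\<And>n. q (u n) \<le> B" using cauchy_bounded[OF assms(1)] by blast
  show ?thesis
  proof (rule null_dominated)
    show "(\<lambda>n. q (v n) * B) \<longlonglongrightarrow> 0"
      using tendsto_mult_left_zero[of "\<lambda>n. q (v n)"] assms by (simp add: null_def)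
    fix n
    have "q (v n * u n) \<le> q (v n) * q (u n)" using assms by (simp add: q_mult)
    also have "\<dots> \<le> q (v n) * B" using B(2) assms by (intro mult_left_mono) simp_all
    finally show "q (v n * u n) \<le> q (v n) * B" .
  qed (use assms in simp)
qed

lemma null_minus: "null u \<Longrightarrow> null (\<lambda>n. - u n)"
  using null_mult_left[of "\<lambda>_. -1" u] by simp

lemma null_diff: "null u \<Longrightarrow> null v \<Longrightarrow> null (\<lambda>n. u n - v n)"
  using null_add[OF _ null_minus] by fastforce

lemma null_cauchy:
  assumes "null u" shows "cauchy u"
  unfolding cauchy_def
proof (intro conjI allI impI)
  fix d :: real assume "0 < d"
  then have "\<forall>\<^sub>F n in sequentially. q (u n) < d / 2"
    using assms unfolding null_def by (intro order_tendstoD[of _ 0]) simp_all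
  then obtain K where K: "\<And>n. n \<ge> K \<Longrightarrow> q (u n) < d / 2" unfolding eventually_sequentially by blast
  have "q (u m - u n) < d" if "m \<ge> K" "n \<ge> K" for m n
    using K[OF that(1)] K[OF that(2)] q_triangle_diff[of "u m" "u n"] assms by simp
  then show "\<exists>K. \<forall>m\<ge>K. \<forall>n\<ge>K. q (u m - u n) < d" by blast
qed (use assms in simp)

section \<open>The completion as a quotient algebra\<close>

abbreviation "M \<equiv> concrete_algebra A \<iota>"
abbreviation "CA \<equiv> cauchy_alg M q"
abbreviation "NS \<equiv> null_seqs M q"

lemma ring_concrete: "ring M"
proof (rule ringI)
  show "abelian_group M"
  proof (rule abelian_groupI)
    fix x assume "x \<in> carrier M"
    then show "\<exists>y\<in>carrier M. y \<oplus>\<^bsub>M\<^esub> x = \<zero>\<^bsub>M\<^esub>" by (intro bexI[of _ "- x"]) simp_all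
  qed (simp_all add: add.assoc add.commute)
  show "Group.monoid M" by (rule monoidI) (simp_all add: mult.assoc)
qed (simp_all add: algebra_simps)

lemma a_minus_concrete:
  assumes "x \<in> A" "y \<in> A" shows "x \<ominus>\<^bsub>M\<^esub> y = x - y"
proof -
  interpret M: ring M by (rule ring_concrete)
  have "\<ominus>\<^bsub>M\<^esub> y = - y" by (rule M.minus_equality) (use assms in simp_all)
  then show ?thesis by (simp add: a_minus_def)
qed

lemma CA_simps:
  "carrier CA = Collect cauchy" "mult CA = (\<lambda>u v n. u n * v n)" "one CA = (\<lambda>_. 1)"
  "zero CA = (\<lambda>_. 0)" "add CA = (\<lambda>u v n. u n + v n)" "smult CA = (\<lambda>c u n. \<iota> c * u n)"
  using a_minus_concrete by (auto simp: cauchy_alg_def cauchy_def)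

lemma NS_eq: "NS = Collect null"
  by (auto simp: null_seqs_def null_def)

sublocale concrete: unital_algebra M
  by (intro unital_algebra.intro unital_algebra_axioms.intro ring_concrete) simp_all

text \<open>Null sequences form an ideal because Cauchy sequences are bounded. The facts on quotient
  algebras thus become available for the completion.\<close>

sublocale completion: unital_algebra_ideal NS CA
proof (intro unital_algebra_ideal.intro unital_algebra.intro unital_algebra_axioms.intro)
  show r: "ring CA"
  proof (rule ringI)
    show "abelian_group CA"
    proof (rule abelian_groupI)
      fix u assume "u \<in> carrier CA"
      then show "\<exists>v\<in>carrier CA. v \<oplus>\<^bsub>CA\<^esub> u = \<zero>\<^bsub>CA\<^esub>"
        by (intro bexI[of _ "\<lambda>n. - u n"]) (simp_all add: CA_simps)
    qed (simp_all add: CA_simps add_ac)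
    show "Group.monoid CA" by (rule monoidI) (simp_all add: CA_simps mult.assoc)
  qed (simp_all add: CA_simps algebra_simps)
  interpret CA: ring CA by (rule r)
  show "ideal NS CA"
  proof (rule idealI[OF r])
    show "subgroup NS (add_monoid CA)"
    proof (rule CA.add.subgroupI)
      show "NS \<subseteq> carrier CA" by (auto simp: NS_eq CA_simps null_cauchy)
      show "NS \<noteq> {}" using null_const_iff[of 0] by (auto simp: NS_eq)
      fix u assume u: "u \<in> NS"
      then have "\<ominus>\<^bsub>CA\<^esub> u = (\<lambda>n. - u n)"
        by (intro CA.minus_equality) (simp_all add: CA_simps NS_eq null_cauchy)
      then show "\<ominus>\<^bsub>CA\<^esub> u \<in> NS" using u null_minus by (simp add: NS_eq)
    qed (simp add: CA_simps NS_eq null_add)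
  qed (simp_all add: CA_simps NS_eq null_mult_left null_mult_right)
qed (simp_all add: CA_simps)

lemma CA_minus:
  assumes "cauchy u" "cauchy v" shows "u \<ominus>\<^bsub>CA\<^esub> v = (\<lambda>n. u n - v n)"
proof -
  have "\<ominus>\<^bsub>CA\<^esub> v = (\<lambda>n. - v n)"
    by (rule completion.minus_equality) (use assms in \<open>simp_all add: CA_simps\<close>)
  then show ?thesis by (simp add: a_minus_def CA_simps)
qed

definition cls :: "(nat \<Rightarrow> 'b) \<Rightarrow> (nat \<Rightarrow> 'b) set" where
  "cls u = NS +>\<^bsub>CA\<^esub> u"

lemma cls_eq_iff: "cauchy u \<Longrightarrow> cauchy v \<Longrightarrow> cls u = cls v \<longleftrightarrow> null (\<lambda>n. u n - v n)"
  using completion.quot_eq_iff[of u v] CA_minus[of u v] NS_eq by (simp add: cls_def CA_simps)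

lemma cls_ops:
  "cauchy u \<Longrightarrow> cauchy v \<Longrightarrow> cls u \<oplus>\<^bsub>completion.Q\<^esub> cls v = cls (\<lambda>n. u n + v n)"
  "cauchy u \<Longrightarrow> cauchy v \<Longrightarrow> cls u \<otimes>\<^bsub>completion.Q\<^esub> cls v = cls (\<lambda>n. u n * v n)"
  "\<zero>\<^bsub>completion.Q\<^esub> = cls (\<lambda>_. 0)" "carrier completion.Q = cls ` Collect cauchy"
  by (simp_all add: cls_def[abs_def] completion.quot_simps CA_simps)

text \<open>For \<open>Y\<close> represented by \<open>u\<close> with \<open>Y e = Y\<close>, the
  compressions of \<open>st (u n) * u n\<close> are scalars \<open>c n\<close> times
  \<open>e\<close>. Their limit is nonzero, which provides a left inverse of \<open>Y\<close>
  relative to \<open>e\<close>.\<close>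

lemma minimal_left_ideal_completion:
  assumes e: "e \<in> A" "st e = e" "e * e \<approx> e" "q e \<noteq> 0"
    and compression: "\<And>b. b \<in> A \<Longrightarrow> \<exists>c. e * b * e \<approx> \<iota> c * e"
  shows "minimal_left_ideal {Y \<in> carrier completion.Q. Y \<otimes>\<^bsub>completion.Q\<^esub> cls (\<lambda>_. e) = Y} completion.Q"
proof (rule completion.quot.minimal_left_ideal_idempotent)
  interpret P: cstar_seminormed_projection A \<iota> st q e by unfold_locales (use e in simp_all)
  show "cls (\<lambda>_. e) \<in> carrier completion.Q" using e by (simp add: cls_ops)
  show "cls (\<lambda>_. e) \<noteq> \<zero>\<^bsub>completion.Q\<^esub>" using e by (simp add: cls_ops cls_eq_iff null_const_iff)
  show "cls (\<lambda>_. e) \<otimes>\<^bsub>completion.Q\<^esub> cls (\<lambda>_. e) = cls (\<lambda>_. e)"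
    using e by (simp add: cls_ops cls_eq_iff null_const_iff eqv_def)
  fix Y assume "Y \<in> carrier completion.Q" and YE: "Y \<otimes>\<^bsub>completion.Q\<^esub> cls (\<lambda>_. e) = Y"
    and Y0: "Y \<noteq> \<zero>\<^bsub>completion.Q\<^esub>"
  then obtain u where u: "cauchy u" and Y: "Y = cls u" by (auto simp: cls_ops)
  have ue: "null (\<lambda>n. u n * e - u n)" using YE u e by (simp add: Y cls_ops cls_eq_iff)
  have nu: "\<not> null u" using Y0 u by (simp add: Y cls_ops cls_eq_iff)
  have uA [simp]: "u n \<in> A" for n using u by simp
  have "\<exists>c. e * (st (u n) * u n) * e \<approx> \<iota> c * e" for n by (intro compression) simp
  then obtain c where c: "\<And>n. e * (st (u n) * u n) * e \<approx> \<iota> (c n) * e" by metis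
  have "cauchy (\<lambda>n. e * (st (u n) * u n) * e)" using u e by simp
  \<comment> \<open>As \<open>q e = 1\<close>, passing from a scalar to its multiple of
    \<open>e\<close> is isometric, so \<open>c\<close> inherits the Cauchy property.\<close>
  moreover have dist: "q (e * (st (u m) * u m) * e - e * (st (u n) * u n) * e) = cmod (c m - c n)" for m n
  proof -
    have "q (e * (st (u m) * u m) * e - e * (st (u n) * u n) * e) = q (\<iota> (c m) * e - \<iota> (c n) * e)"
      by (rule P.q_diff_cong[OF c c])
    also have "\<iota> (c m) * e - \<iota> (c n) * e = \<iota> (c m - c n) * e"
      using scalar_add[of "c m - c n" "c n"] by (simp add: algebra_simps)
    finally show ?thesis by (simp add: q_scalar P.q_e)
  qed
  ultimately have "Cauchy c" unfolding cauchy_def dist by (intro CauchyI) auto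
  then obtain l where l: "c \<longlonglongrightarrow> l" using Cauchy_convergent_iff convergent_def by blast
  \<comment> \<open>By the C*-identity \<open>q (u n * e)\<close> is the square root of
    \<open>cmod (c n)\<close>; the limit 0 would make \<open>u\<close> null.\<close>
  have "l \<noteq> 0"
  proof
    assume "l = 0"
    then have "(\<lambda>n. sqrt (cmod (c n))) \<longlonglongrightarrow> 0"
      using tendsto_real_sqrt[OF tendsto_norm[OF l]] by simp
    moreover have "q (u n * e) = sqrt (cmod (c n))" for n
    proof -
      have "(q (u n * e))\<^sup>2 = q (st (u n * e) * (u n * e))" by (rule q_star_mult [symmetric]) simp
      also have "st (u n * e) * (u n * e) = e * (st (u n) * u n) * e" by (simp add: star_mult mult.assoc)
      also have "q \<dots> = cmod (c n)" using q_cong[OF c[of n]] by (simp add: q_scalar P.q_e)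
      finally show ?thesis by (intro real_sqrt_unique [symmetric]) simp_all
    qed
    ultimately have "null (\<lambda>n. u n * e)" by (simp add: null_def)
    from null_diff[OF this ue] show False using nu by simp
  qed
  \<comment> \<open>In the limit \<open>e\<close> times the adjoint of \<open>Y\<close> sends
    \<open>Y\<close> to \<open>l e\<close>; dividing by \<open>l\<close> gives the left
    inverse.\<close>
  define z where "z n = \<iota> (1 / l) * (e * st (u n))" for n
  have z: "cauchy z" unfolding z_def using u e by simp
  have zA [simp]: "z n \<in> A" for n using z by simp
  have zue: "null (\<lambda>n. z n * (u n * e - u n))" by (rule null_mult_left[OF z ue])
  have "null (\<lambda>n. z n * u n * e - e)"
  proof (rule null_dominated)
    have "(\<lambda>n. c n / l) \<longlonglongrightarrow> l / l" using l \<open>l \<noteq> 0\<close> by (intro tendsto_divide) simp_all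
    then have "(\<lambda>n. c n / l - 1) \<longlonglongrightarrow> 0" using \<open>l \<noteq> 0\<close> LIM_zero by fastforce
    then show "(\<lambda>n. cmod (c n / l - 1)) \<longlonglongrightarrow> 0" by (rule tendsto_norm_zero)
    fix n
    have "z n * u n * e = \<iota> (1 / l) * (e * (st (u n) * u n) * e)" by (simp add: z_def mult.assoc)
    also have "\<dots> \<approx> \<iota> (1 / l) * (\<iota> (c n) * e)" by (intro eqv_mult_left c) simp
    also have "\<dots> = \<iota> (c n / l) * e" by (simp flip: mult.assoc scalar_mult)
    finally have "q (z n * u n * e - e) = q (\<iota> (c n / l) * e - e)" by (intro P.q_diff_cong) simp_all
    also have "\<iota> (c n / l) * e - e = \<iota> (c n / l - 1) * e"
      using scalar_add[of "c n / l - 1" 1] by (simp add: algebra_simps)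
    finally show "q (z n * u n * e - e) \<le> cmod (c n / l - 1)" by (simp add: q_scalar P.q_e)
  qed simp
  \<comment> \<open>Replacing \<open>u n * e\<close> by \<open>u n\<close> costs only the null
    sequence \<open>zue\<close>.\<close>
  from null_diff[OF this zue] have "null (\<lambda>n. z n * u n * e - e - z n * (u n * e - u n))" .
  then have "null (\<lambda>n. z n * u n - e)" by (simp add: algebra_simps)
  then have "cls z \<otimes>\<^bsub>completion.Q\<^esub> Y = cls (\<lambda>_. e)" using u z by (simp add: Y cls_ops cls_eq_iff)
  moreover have "cls z \<in> carrier completion.Q" using z by (simp add: cls_ops)
  ultimately show "\<exists>Z\<in>carrier completion.Q. Z \<otimes>\<^bsub>completion.Q\<^esub> Y = cls (\<lambda>_. e)" by blast
qed

lemma Soc_completion: "Soc (completion M st q) = Soc completion.Q"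
  unfolding completion_def by (rule Soc_module_extend)

text \<open>The image of each minimal left ideal is zero or lies in the minimal left ideal generated
  by a projection; additivity of the map then covers finite sums.\<close>

theorem Soc_quotient_subset_Soc_completion:
  assumes I: "ideal I M" and null_I: "\<And>x. x \<in> I \<Longrightarrow> q x = 0"
  shows "(\<lambda>C. \<Union>x\<in>C. NS +>\<^bsub>CA\<^esub> (\<lambda>_. x)) ` Soc (alg_quot M I) \<subseteq> Soc (completion M st q)"
    (is "?h ` _ \<subseteq> _")
proof -
  interpret Q: unital_algebra_ideal I M
    by (intro unital_algebra_ideal.intro concrete.unital_algebra_axioms I)
  have h: "?h (I +>\<^bsub>M\<^esub> x) = cls (\<lambda>_. x)" if x: "x \<in> A" for x
  proof -
    \<comment> \<open>Representatives of one coset differ by an element of \<open>I\<close>, on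
      which \<open>q\<close> vanishes.\<close>
    have "cls (\<lambda>_. y) = cls (\<lambda>_. x)" if "y \<in> I +>\<^bsub>M\<^esub> x" for y
    proof -
      have "y \<in> A" "y - x \<in> I" using Q.quot_rep[OF _ that] x by (simp_all add: a_minus_concrete)
      then show ?thesis using x null_I by (simp add: cls_eq_iff null_const_iff)
    qed
    moreover have "I +>\<^bsub>M\<^esub> x \<noteq> {}" using Q.quot_rep_self[of x] x by auto
    ultimately have "(\<Union>y\<in>I +>\<^bsub>M\<^esub> x. cls (\<lambda>_. y)) = cls (\<lambda>_. x)" by (rule SUP_eq_const[rotated])
    then show ?thesis by (simp add: cls_def)
  qed
  have min: "cls (\<lambda>_. y) \<in> Soc completion.Q"
    if L: "minimal_left_ideal L Q.Q" and y: "y \<in> A" "I +>\<^bsub>M\<^esub> y \<in> L" for L y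
  proof -
    \<comment> \<open>The preimage of \<open>L\<close> in \<open>A\<close>, to which
      \<open>minimal_projection\<close> is applied.\<close>
    define L' where "L' = {x \<in> A. I +>\<^bsub>M\<^esub> x \<in> L}"
    show ?thesis
    proof (cases "\<forall>x\<in>L'. q x = 0")
      case True
      then have "q y = 0" using y by (simp add: L'_def)
      then have "cls (\<lambda>_. y) = \<zero>\<^bsub>completion.Q\<^esub>" using y by (simp add: cls_ops cls_eq_iff null_const_iff)
      then show ?thesis using completion.quot.Soc_zero by simp
    next
      case False
      then obtain x where x: "x \<in> L'" "q x \<noteq> 0" by blast
      have LI: "left_ideal L Q.Q" using L by (simp add: minimal_left_ideal_def)
      then interpret L: additive_subgroup L Q.Q by (simp add: left_ideal_def)
      have mult: "a * x \<in> L'" if "a \<in> A" "x \<in> L'" for a x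
      proof -
        have "I +>\<^bsub>M\<^esub> a \<in> carrier Q.Q" using that by (simp add: Q.quot_simps)
        then have "(I +>\<^bsub>M\<^esub> a) \<otimes>\<^bsub>Q.Q\<^esub> (I +>\<^bsub>M\<^esub> x) \<in> L"
          using that LI unfolding left_ideal_def L'_def by blast
        then show ?thesis using that Q.quot_simps(2)[of a x] by (simp add: L'_def)
      qed
      have diff: "x - y \<in> L'" if "x \<in> L'" "y \<in> L'" for x y
      proof -
        have "I +>\<^bsub>M\<^esub> (- y) \<in> L" using mult[of "-1" y] that by (simp add: L'_def)
        then have "(I +>\<^bsub>M\<^esub> x) \<oplus>\<^bsub>Q.Q\<^esub> (I +>\<^bsub>M\<^esub> (- y)) \<in> L" using that by (simp add: L'_def L.a_closed)
        then show ?thesis using that Q.quot_simps(1)[of x "- y"] by (simp add: L'_def)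
      qed
      \<comment> \<open>An element with \<open>q x \<noteq> 0\<close> lies outside \<open>I\<close>,
        so its coset generates \<open>L\<close>; the error term lies in \<open>I\<close> and is
        therefore null.\<close>
      have gen: "\<exists>a\<in>A. z \<approx> a * x" if "x \<in> L'" "q x \<noteq> 0" "z \<in> L'" for x z
      proof -
        have "\<exists>a\<in>carrier M. z \<ominus>\<^bsub>M\<^esub> a \<otimes>\<^bsub>M\<^esub> x \<in> I"
          using that null_I by (intro Q.minimal_left_ideal_generates[OF L]) (auto simp: L'_def)
        then show ?thesis using that null_I by (auto simp: a_minus_concrete eqv_def L'_def)
      qed
      obtain e where e: "e \<in> A" "st e = e" "e * e \<approx> e" "q e \<noteq> 0" "\<And>y. y \<in> L' \<Longrightarrow> y * e \<approx> y"
        "\<And>b. b \<in> A \<Longrightarrow> \<exists>c. e * b * e \<approx> \<iota> c * e"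
        by (rule minimal_projection[of L' x]) (use mult diff gen x in \<open>auto simp: L'_def\<close>)
      have "y * e \<approx> y" using e(5) y by (simp add: L'_def)
      then have "cls (\<lambda>_. y) \<otimes>\<^bsub>completion.Q\<^esub> cls (\<lambda>_. e) = cls (\<lambda>_. y)"
        using y e(1) by (simp add: cls_ops cls_eq_iff null_const_iff eqv_def)
      then have "cls (\<lambda>_. y) \<in> {Y \<in> carrier completion.Q. Y \<otimes>\<^bsub>completion.Q\<^esub> cls (\<lambda>_. e) = Y}"
        using y by (simp add: cls_ops)
      then show ?thesis
        using completion.quot.minimal_left_ideal_subset_Soc minimal_left_ideal_completion e by blast
    qed
  qed
  have "X \<in> carrier Q.Q \<and> ?h X \<in> Soc completion.Q" if "X \<in> Soc Q.Q" for X
  proof (rule Q.quot.Soc_induct[OF that])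
    have "?h \<zero>\<^bsub>Q.Q\<^esub> = \<zero>\<^bsub>completion.Q\<^esub>" by (simp add: Q.quot_simps h cls_ops del: UN_simps)
    then show "\<zero>\<^bsub>Q.Q\<^esub> \<in> carrier Q.Q \<and> ?h \<zero>\<^bsub>Q.Q\<^esub> \<in> Soc completion.Q"
      using completion.quot.Soc_zero by simp
  next
    fix L X Y
    assume L: "minimal_left_ideal L Q.Q" "X \<in> L" and Y: "Y \<in> carrier Q.Q" "Y \<in> carrier Q.Q \<and> ?h Y \<in> Soc completion.Q"
    have "X \<in> carrier Q.Q" by (rule Q.quot.minimal_left_ideal_carrier[OF L])
    then obtain x y where x: "x \<in> A" "X = I +>\<^bsub>M\<^esub> x" and y: "y \<in> A" "Y = I +>\<^bsub>M\<^esub> y"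
      using Y(1) by (auto simp: Q.quot_simps)
    have "?h (X \<oplus>\<^bsub>Q.Q\<^esub> Y) = cls (\<lambda>_. x) \<oplus>\<^bsub>completion.Q\<^esub> cls (\<lambda>_. y)"
      using x y h[of "x + y"] by (simp add: Q.quot_simps cls_ops)
    moreover have "cls (\<lambda>_. y) \<in> Soc completion.Q" using Y(2) h[of y] y by simp
    ultimately have "?h (X \<oplus>\<^bsub>Q.Q\<^esub> Y) \<in> Soc completion.Q"
      using min[OF L(1) x(1)] L(2) x(2) completion.quot.Soc_add by simp
    then show "X \<oplus>\<^bsub>Q.Q\<^esub> Y \<in> carrier Q.Q \<and> ?h (X \<oplus>\<^bsub>Q.Q\<^esub> Y) \<in> Soc completion.Q"
      using \<open>X \<in> carrier Q.Q\<close> Y(1) by simp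
  qed
  then show ?thesis unfolding Soc_completion by blast
qed

end

section \<open>The free *-algebra and its universal C*-seminorm\<close>

text \<open>Reduces additive identities in the free algebra to monomials.\<close>

lemma poly_mapping_add_induct [case_names single sum]:
  fixes f :: "'k \<Rightarrow>\<^sub>0 'c::comm_monoid_add"
  assumes single: "\<And>k v. P (Poly_Mapping.single k v)" and sum: "\<And>f g. P f \<Longrightarrow> P g \<Longrightarrow> P (f + g)"
  shows "P f"
proof -
  have "P (\<Sum>k\<in>K. Poly_Mapping.single k (Poly_Mapping.lookup f k))" if "finite K" for K
    using that
  proof (induction K)
    case empty
    show ?case using single[of _ 0] by simp
  qed (simp add: single sum)
  moreover have "(\<Sum>k\<in>Poly_Mapping.keys f. Poly_Mapping.single k (Poly_Mapping.lookup f k)) = f"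
    by (rule poly_mapping_eqI) (simp add: lookup_sum lookup_single when_def in_keys_iff)
  ultimately show ?thesis by (metis finite_keys)
qed

text \<open>The index \<open>0\<close> is the empty word, the neutral element of the monoid of
  words.\<close>

abbreviation scalar :: "complex \<Rightarrow> 'a ncpoly" where
  "scalar c \<equiv> Poly_Mapping.single 0 c"

text \<open>Makes the general theorem on concrete algebras applicable to
  \<open>free_alg\<close>.\<close>

lemma free_alg_eq: "free_alg X = concrete_algebra (carrier (free_alg X)) scalar"
  by (simp add: free_alg_def concrete_algebra_def mult_map_scale_conv_mult fun_eq_iff)

lemma scalar_commute: "x * scalar c = scalar c * (x :: 'a ncpoly)"
proof (induction x rule: poly_mapping_add_induct)
  case (single k v)
  then show ?case by (simp add: mult_single mult.commute)
next
  case (sum f g)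
  then show ?case by (simp add: algebra_simps)
qed

text \<open>Words outside the support contribute zero. A larger index set is needed to compare
  \<open>f\<close>, \<open>g\<close> and \<open>f + g\<close> over the same words.\<close>

lemma star_eq_sum:
  assumes "finite W" "Poly_Mapping.keys f \<subseteq> W"
  shows "star f = (\<Sum>w\<in>W. Poly_Mapping.single (rev (map gen_star w)) (cnj (Poly_Mapping.lookup f w)))"
  unfolding star_def using assms by (intro sum.mono_neutral_left) (auto simp: in_keys_iff)

lemma star_add: "star (f + g) = star f + star g"
proof -
  let ?W = "Poly_Mapping.keys f \<union> Poly_Mapping.keys g"
  have "star f = (\<Sum>w\<in>?W. Poly_Mapping.single (rev (map gen_star w)) (cnj (Poly_Mapping.lookup f w)))"
    "star g = (\<Sum>w\<in>?W. Poly_Mapping.single (rev (map gen_star w)) (cnj (Poly_Mapping.lookup g w)))"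
    "star (f + g) = (\<Sum>w\<in>?W. Poly_Mapping.single (rev (map gen_star w)) (cnj (Poly_Mapping.lookup (f + g) w)))"
    using Poly_Mapping.keys_add[of f g] by (intro star_eq_sum; simp)+
  then show ?thesis by (simp add: lookup_add single_add sum.distrib)
qed

lemma star_single: "star (Poly_Mapping.single w c) = Poly_Mapping.single (rev (map gen_star w)) (cnj c)"
  by (subst star_eq_sum[of "{w}"]) simp_all

lemma star_mult: "star (f * g) = star g * star f"
proof (induction f rule: poly_mapping_add_induct)
  case (single k v)
  show ?case
  proof (induction g rule: poly_mapping_add_induct)
    case (single l w)
    show ?case by (simp add: mult_single star_single plus_list_def mult.commute)
  next
    case (sum f g)
    then show ?case by (simp add: star_add distrib_left distrib_right)
  qed
next
  case (sum f g)
  then show ?case by (simp add: star_add distrib_left distrib_right)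
qed

lemma gen_star_gen_star [simp]: "gen_star (gen_star g) = g"
  by (cases g) simp_all

lemma star_star: "star (star f) = f"
proof (induction f rule: poly_mapping_add_induct)
  case (single k v)
  show ?case by (simp add: star_single rev_map comp_def)
next
  case (sum f g)
  then show ?case by (simp add: star_add)
qed

lemma gen_star_closed: "g \<in> gens X \<Longrightarrow> gen_star g \<in> gens X"
  by (auto simp: gens_def)

lemma star_closed:
  assumes "f \<in> carrier (free_alg X)" shows "star f \<in> carrier (free_alg X)"
  unfolding free_alg_carrier
proof
  fix v assume "v \<in> Poly_Mapping.keys (star f)"
  also have "\<dots> \<subseteq> (\<Union>w\<in>Poly_Mapping.keys f. Poly_Mapping.keys
      (Poly_Mapping.single (rev (map gen_star w)) (cnj (Poly_Mapping.lookup f w))))"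
    unfolding star_def by (rule keys_sum)
  finally obtain w where "w \<in> Poly_Mapping.keys f" "v = rev (map gen_star w)"
    by (auto split: if_splits)
  then show "set v \<subseteq> gens X" using assms by (auto simp: free_alg_carrier intro: gen_star_closed)
qed

text \<open>Ensures that the supremum defining \<open>univ_seminorm\<close> is over a nonempty
  set.\<close>

lemma cstar_seminorm_zero: "cstar_seminorm X (\<lambda>_. 0)"
  by (simp add: cstar_seminorm_def)

section \<open>The universal C*-seminorm and its kernel\<close>

context
  fixes X :: "'a word set"
  assumes nonempty: "X \<noteq> {}"
begin

lemma cstar_seminorm_le:
  assumes "cstar_seminorm X q" "x \<in> carrier (free_alg X)" shows "q x \<le> univ_seminorm X x"
  unfolding univ_seminorm_def
  using cstar_seminorm_bdd[OF nonempty assms(2)] assms(1)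
  by (intro cSUP_upper) (simp_all add: setcompr_eq_image)

lemma univ_seminorm_least:
  assumes "\<And>q. cstar_seminorm X q \<Longrightarrow> q x \<le> B" shows "univ_seminorm X x \<le> B"
  unfolding univ_seminorm_def using assms cstar_seminorm_zero by (intro cSUP_least) auto

text \<open>Each condition on a C*-seminorm survives a pointwise bounded supremum.\<close>

lemma cstar_seminorm_univ: "cstar_seminorm X (univ_seminorm X)"
proof -
  let ?F = "carrier (free_alg X)" and ?u = "univ_seminorm X"
  note le = cstar_seminorm_le and least = univ_seminorm_least
  have nn: "0 \<le> ?u x" if "x \<in> ?F" for x using le[OF cstar_seminorm_zero that] .
  have tri: "?u (x + y) \<le> ?u x + ?u y" if "x \<in> ?F" "y \<in> ?F" for x y
  proof (rule least)
    fix q assume q: "cstar_seminorm X q"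
    then have "q (x + y) \<le> q x + q y" using that by (simp add: cstar_seminorm_def)
    then show "q (x + y) \<le> ?u x + ?u y" using le[OF q that(1)] le[OF q that(2)] by linarith
  qed
  have scale_le: "?u (c \<odot>\<^bsub>free_alg X\<^esub> x) \<le> cmod c * ?u x" if "x \<in> ?F" for c x
  proof (rule least)
    fix q assume q: "cstar_seminorm X q"
    then have "q (c \<odot>\<^bsub>free_alg X\<^esub> x) = cmod c * q x" using that unfolding cstar_seminorm_def by blast
    then show "q (c \<odot>\<^bsub>free_alg X\<^esub> x) \<le> cmod c * ?u x" using le[OF q that] by (simp add: mult_left_mono)
  qed
  have scale: "?u (c \<odot>\<^bsub>free_alg X\<^esub> x) = cmod c * ?u x" if x: "x \<in> ?F" for c x
  proof (cases "c = 0")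
    case True
    then have c0: "c \<odot>\<^bsub>free_alg X\<^esub> x = 0" by (simp add: mult_map_scale_conv_mult)
    show ?thesis using scale_le[OF x, of c] nn[OF free_alg_zero_one(1)] True unfolding c0 by simp
  next
    case False
    have "scalar c \<in> ?F" by (simp add: free_alg_carrier zero_list_def)
    then have cx: "c \<odot>\<^bsub>free_alg X\<^esub> x \<in> ?F"
      using free_alg_closed(4) x by (simp only: mult_map_scale_conv_mult free_alg_simps)
    \<comment> \<open>The reverse inequality is the one already proved, applied to the scalar
      \<open>1 / c\<close>.\<close>
    have "(1 / c) \<odot>\<^bsub>free_alg X\<^esub> (c \<odot>\<^bsub>free_alg X\<^esub> x) = x"
      using False by (simp add: mult_map_scale_conv_mult mult_single flip: mult.assoc)
    then have "?u x \<le> cmod (1 / c) * ?u (c \<odot>\<^bsub>free_alg X\<^esub> x)" using scale_le[OF cx, of "1 / c"] by simp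
    then have "cmod c * ?u x \<le> ?u (c \<odot>\<^bsub>free_alg X\<^esub> x)" using False by (simp add: norm_divide field_simps)
    then show ?thesis using scale_le[OF x, of c] by simp
  qed
  have mult: "?u (x * y) \<le> ?u x * ?u y" if "x \<in> ?F" "y \<in> ?F" for x y
  proof (rule least)
    fix q assume q: "cstar_seminorm X q"
    then have "q (x * y) \<le> q x * q y" "0 \<le> q x" "0 \<le> q y"
      using that by (simp_all add: cstar_seminorm_def)
    then show "q (x * y) \<le> ?u x * ?u y"
      using mult_mono[OF le[OF q that(1)] le[OF q that(2)]] nn[OF that(1)] by linarith
  qed
  have cstar: "?u (star x * x) = (?u x)\<^sup>2" if x: "x \<in> ?F" for x
  proof (rule antisym)
    have sx: "star x * x \<in> ?F" using x by (intro free_alg_closed star_closed)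
    show "?u (star x * x) \<le> (?u x)\<^sup>2"
    proof (rule least)
      fix q assume q: "cstar_seminorm X q"
      then have "q (star x * x) = (q x)\<^sup>2" "0 \<le> q x" using x by (simp_all add: cstar_seminorm_def)
      then show "q (star x * x) \<le> (?u x)\<^sup>2" using le[OF q x] by (simp add: power_mono)
    qed
    \<comment> \<open>The square root turns the C*-identity of each \<open>q\<close> into an upper
      bound on \<open>q x\<close>, which passes to the supremum.\<close>
    have "?u x \<le> sqrt (?u (star x * x))"
    proof (rule least)
      fix q assume q: "cstar_seminorm X q"
      then have "q (star x * x) = (q x)\<^sup>2" using x by (simp add: cstar_seminorm_def)
      then show "q x \<le> sqrt (?u (star x * x))" using le[OF q sx] by (intro real_le_rsqrt) simp
    qed
    then have "(?u x)\<^sup>2 \<le> (sqrt (?u (star x * x)))\<^sup>2" using nn[OF x] by (rule power_mono)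
    then show "(?u x)\<^sup>2 \<le> ?u (star x * x)" using nn[OF sx] by simp
  qed
  have rel: "?u r = 0" if "r \<in> relators X" for r
  proof (rule antisym)
    show "?u r \<le> 0" using that by (intro least) (simp add: cstar_seminorm_def)
    show "0 \<le> ?u r" using that relators_carrier[OF nonempty] by (intro nn) blast
  qed
  show ?thesis unfolding cstar_seminorm_def using nn tri scale mult cstar rel by simp
qed

interpretation cstar_seminormed "carrier (free_alg X)" scalar star "univ_seminorm X"
proof
  note u = cstar_seminorm_univ[unfolded cstar_seminorm_def]
  fix x y :: "'a ncpoly" and c d :: complex
  show "scalar c \<in> carrier (free_alg X)" by (simp add: free_alg_carrier zero_list_def)
  show "scalar (c + d) = scalar c + scalar d" by (rule single_add)
  show "scalar (c * d) = scalar c * scalar d" by (simp add: mult_single)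
  show "scalar 1 = 1" by simp
  show "star (scalar c) = scalar (cnj c)" by (simp add: star_single zero_list_def)
  show "star (x + y) = star x + star y" by (rule star_add)
  show "star (x * y) = star y * star x" by (rule star_mult)
  show "star (star x) = x" by (rule star_star)
  show "x * scalar c = scalar c * x" by (rule scalar_commute)
  assume x: "x \<in> carrier (free_alg X)"
  show "star x \<in> carrier (free_alg X)" using x by (rule star_closed)
  show "0 \<le> univ_seminorm X x" "univ_seminorm X (star x * x) = (univ_seminorm X x)\<^sup>2" using u x by simp_all
  show "univ_seminorm X (scalar c * x) = cmod c * univ_seminorm X x"
    using u x by (simp flip: mult_map_scale_conv_mult)
  assume y: "y \<in> carrier (free_alg X)"
  show "x - y \<in> carrier (free_alg X)" "x * y \<in> carrier (free_alg X)" using x y by (simp_all add: free_alg_closed)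
  show "univ_seminorm X (x + y) \<le> univ_seminorm X x + univ_seminorm X y"
    "univ_seminorm X (x * y) \<le> univ_seminorm X x * univ_seminorm X y" using u x y by simp_all
qed

text \<open>The kernel of the seminorm is a two-sided ideal containing the relators, hence contains
  the ideal they generate.\<close>

lemma univ_seminorm_relation_ideal:
  assumes "x \<in> Idl\<^bsub>free_alg X\<^esub> (relators X)" shows "univ_seminorm X x = 0"
proof -
  let ?K = "{x \<in> carrier (free_alg X). univ_seminorm X x = 0}"
  interpret R: ring "free_alg X" by (rule free_alg_ring)
  have K: "x \<in> ?K \<longleftrightarrow> eqv x 0" for x by (simp add: eqv_0_iff)
  have "ideal ?K (free_alg X)"
  proof (rule idealI[OF free_alg_ring])
    show "subgroup ?K (add_monoid (free_alg X))"
    proof (rule R.add.subgroupI)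
      fix x assume x: "x \<in> ?K"
      then have "\<ominus>\<^bsub>free_alg X\<^esub> x = - x" by (intro R.minus_equality) simp_all
      then show "\<ominus>\<^bsub>free_alg X\<^esub> x \<in> ?K" using x by simp
    next
      fix x y assume "x \<in> ?K" "y \<in> ?K"
      then show "x \<oplus>\<^bsub>free_alg X\<^esub> y \<in> ?K" unfolding K using eqv_add[of x 0 y 0] by simp
    qed (use zero_closed q_0 in auto)
  next
    fix a x assume "a \<in> ?K" and x: "x \<in> carrier (free_alg X)"
    then have a: "eqv a 0" by (simp add: eqv_0_iff)
    show "x \<otimes>\<^bsub>free_alg X\<^esub> a \<in> ?K" "a \<otimes>\<^bsub>free_alg X\<^esub> x \<in> ?K"
      unfolding K using eqv_mult_left[OF x a] eqv_mult_right[OF x a] by simp_all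
  qed
  moreover have "relators X \<subseteq> ?K"
    using relators_carrier[OF nonempty] cstar_seminorm_univ by (auto simp: cstar_seminorm_def)
  ultimately show ?thesis using assms R.genideal_minimal by blast
qed

lemma canonical_map_Soc: "canonical_map X ` Soc (subshift_alg X) \<subseteq> Soc (subshift_cstar X)"
proof -
  have "ideal (Idl\<^bsub>free_alg X\<^esub> (relators X)) (free_alg X)"
    by (rule ring.genideal_ideal[OF free_alg_ring relators_carrier[OF nonempty]])
  then show ?thesis
    using Soc_quotient_subset_Soc_completion[OF _ univ_seminorm_relation_ideal, folded free_alg_eq]
    by (simp add: canonical_map_def[abs_def] subshift_alg_def subshift_cstar_def)
qed

end

theorem proposition6p4:
  fixes X :: "'a word set"
  assumes "subshift X"
    and "\<And>a. \<exists>x\<in>X. a \<in> range x"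
  shows "canonical_map X ` Soc (subshift_alg X) \<subseteq> Soc (subshift_cstar X)"
  \<comment> \<open>Types are inhabited, so there is a letter, and the sequence in which it occurs
    shows \<open>X \<noteq> {}\<close>.\<close>
  using assms(2) by (intro canonical_map_Soc) blast

end
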